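(* Let $\mathbf{P}=(p_{ij})$ be an instance of makespan minimization on unrelated machines with machine set $\mathcal{M}$, $|\mathcal{M}|=m$, and job set $\mathcal{J}$, $|\mathcal{J}|=n$, where $p_{ij}\ge 0$ is the processing time of job $j$ on machine $i$. Let $T>0$ and $L>0$ with $L\le T$, and let $h=h(T)\in(0,1]$ be the feasibility factor of $\mathbf{P}$ with respect to $T$. Suppose the linear program $$\sum_{i=1}^m\sum_{j=1}^n p_{ij}x_{ij}\le mL,\qquad \sum_{i=1}^m x_{ij}=1\ (j=1,\dots,n),\qquad \sum_{j=1}^n p_{ij}x_{ij}\le T\ (i=1,\dots,m),$$ $$x_{ij}\ge 0\ \text{for all } i,j,\qquad x_{ij}=0\ \text{whenever } p_{ij}>T,$$ has a feasible solution. Then there is a polynomial-time algorithm that outputs an assignment $\alpha:\mathcal{J}\to\mathcal{M}$ whose makespan is at most $\min\{T+L/h,\;2T\}$.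
   Context: An assignment is a map $\alpha:\mathcal{J}\to\mathcal{M}$; the load of machine $i$ is $\delta_i(\alpha)=\sum_{j:\alpha(j)=i}p_{ij}$, and the makespan of $\alpha$ is $\max_i\delta_i(\alpha)$. The average machine load of $\alpha$ is $\frac1m\sum_i\delta_i(\alpha)$. A machine $i$ is legal for job $j$ (with respect to $T$) if $p_{ij}\le T$. The feasibility factor of $\mathbf{P}$ with respect to $T$ is $h(T)=\frac{1}{m}\min_{j\in\mathcal{J}}|\{i\in\mathcal{M}: p_{ij}\le T\}|$. *)

theory Defs
  imports Complex_Main "HOL-Library.Log_Nat" "HOL-Computational_Algebra.Polynomial"
begin

section \<open>Makespan minimization on unrelated machines\<close>

text \<open>Machines are \<open>0, \<dots>, m - 1\<close>, jobs are \<open>0, \<dots>, n - 1\<close>; \<open>p i j\<close> is the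
  processing time of job \<open>j\<close> on machine \<open>i\<close>.\<close>

definition is_instance :: "nat \<Rightarrow> nat \<Rightarrow> (nat \<Rightarrow> nat \<Rightarrow> real) \<Rightarrow> bool" where
  "is_instance m n p \<longleftrightarrow> 0 < m \<and> 0 < n \<and> (\<forall>i<m. \<forall>j<n. 0 \<le> p i j)"

definition is_assignment :: "nat \<Rightarrow> nat \<Rightarrow> (nat \<Rightarrow> nat) \<Rightarrow> bool" where
  "is_assignment m n \<alpha> \<longleftrightarrow> (\<forall>j<n. \<alpha> j < m)"

definition load :: "nat \<Rightarrow> (nat \<Rightarrow> nat \<Rightarrow> real) \<Rightarrow> (nat \<Rightarrow> nat) \<Rightarrow> nat \<Rightarrow> real" where
  "load n p \<alpha> i = (\<Sum>j | j < n \<and> \<alpha> j = i. p i j)"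

definition makespan :: "nat \<Rightarrow> nat \<Rightarrow> (nat \<Rightarrow> nat \<Rightarrow> real) \<Rightarrow> (nat \<Rightarrow> nat) \<Rightarrow> real" where
  "makespan m n p \<alpha> = Max (load n p \<alpha> ` {..<m})"

definition feasibility_factor :: "nat \<Rightarrow> nat \<Rightarrow> (nat \<Rightarrow> nat \<Rightarrow> real) \<Rightarrow> real \<Rightarrow> real" where
  "feasibility_factor m n p T =
     1 / real m * real (Min ((\<lambda>j. card {i. i < m \<and> p i j \<le> T}) ` {..<n}))"

definition lp_feasible :: "nat \<Rightarrow> nat \<Rightarrow> (nat \<Rightarrow> nat \<Rightarrow> real) \<Rightarrow> real \<Rightarrow> real \<Rightarrow> bool" where
  "lp_feasible m n p T L \<longleftrightarrow>
     (\<exists>x :: nat \<Rightarrow> nat \<Rightarrow> real.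
        (\<Sum>i<m. \<Sum>j<n. p i j * x i j) \<le> real m * L \<and>
        (\<forall>j<n. (\<Sum>i<m. x i j) = 1) \<and>
        (\<forall>i<m. (\<Sum>j<n. p i j * x i j) \<le> T) \<and>
        (\<forall>i<m. \<forall>j<n. 0 \<le> x i j) \<and>
        (\<forall>i<m. \<forall>j<n. p i j > T \<longrightarrow> x i j = 0))"


section \<open>Model of computation\<close>

text \<open>
  Structured programs over a random access memory of integers, charged by the logarithmic
  cost criterion: every value that is read or computed, including addresses, is charged the
  length of its binary representation. This is the usual random access machine with logarithmic
  cost, whose polynomial-time computations are those of Turing machines. The memory is divided
  into finitely many named arrays per program; a scalar is stored in cell \<open>0\<close> of its array.
\<close>

type_synonym vname = string
type_synonym state = "vname \<Rightarrow> int \<Rightarrow> int"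

definition bit_length :: "int \<Rightarrow> nat" where
  "bit_length k = 1 + floorlog 2 (nat \<bar>k\<bar>)"

datatype aexp =
    Const int
  | Load vname aexp
  | Add aexp aexp
  | Sub aexp aexp
  | Mul aexp aexp
  | Div aexp aexp

fun aval :: "aexp \<Rightarrow> state \<Rightarrow> int" where
  "aval (Const k) s = k"
| "aval (Load x a) s = s x (aval a s)"
| "aval (Add a b) s = aval a s + aval b s"
| "aval (Sub a b) s = aval a s - aval b s"
| "aval (Mul a b) s = aval a s * aval b s"
| "aval (Div a b) s = aval a s div aval b s"

fun acost :: "aexp \<Rightarrow> state \<Rightarrow> nat" where
  "acost (Const k) s = bit_length k"
| "acost (Load x a) s = acost a s + bit_length (aval (Load x a) s)"
| "acost (Add a b) s = acost a s + acost b s + bit_length (aval (Add a b) s)"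
| "acost (Sub a b) s = acost a s + acost b s + bit_length (aval (Sub a b) s)"
| "acost (Mul a b) s = acost a s + acost b s + bit_length (aval (Mul a b) s)"
| "acost (Div a b) s = acost a s + acost b s + bit_length (aval (Div a b) s)"

datatype bexp =
    Less aexp aexp
  | Equal aexp aexp
  | Neg bexp
  | Conj bexp bexp

fun bval :: "bexp \<Rightarrow> state \<Rightarrow> bool" where
  "bval (Less a b) s \<longleftrightarrow> aval a s < aval b s"
| "bval (Equal a b) s \<longleftrightarrow> aval a s = aval b s"
| "bval (Neg b) s \<longleftrightarrow> \<not> bval b s"
| "bval (Conj b c) s \<longleftrightarrow> bval b s \<and> bval c s"

fun bcost :: "bexp \<Rightarrow> state \<Rightarrow> nat" where
  "bcost (Less a b) s = 1 + acost a s + acost b s"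
| "bcost (Equal a b) s = 1 + acost a s + acost b s"
| "bcost (Neg b) s = 1 + bcost b s"
| "bcost (Conj b c) s = 1 + bcost b s + bcost c s"

text \<open>\<open>Store x a b\<close> is the assignment \<open>x[a] := b\<close>.\<close>

datatype com =
    Skip
  | Store vname aexp aexp
  | Seq com com
  | If bexp com com
  | While bexp com

text \<open>\<open>exec c s t s'\<close>: started in state \<open>s\<close>, program \<open>c\<close> halts in state \<open>s'\<close> with total
  cost \<open>t\<close>.\<close>

inductive exec :: "com \<Rightarrow> state \<Rightarrow> nat \<Rightarrow> state \<Rightarrow> bool" where
  Skip: "exec Skip s 1 s"
| Store: "exec (Store x a b) s (1 + acost a s + acost b s)
            (s(x := (s x)(aval a s := aval b s)))"
| Seq: "exec c s t s' \<Longrightarrow> exec d s' t' s'' \<Longrightarrow> exec (Seq c d) s (t + t') s''"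
| IfTrue: "bval b s \<Longrightarrow> exec c s t s' \<Longrightarrow> exec (If b c d) s (bcost b s + t) s'"
| IfFalse: "\<not> bval b s \<Longrightarrow> exec d s t s' \<Longrightarrow> exec (If b c d) s (bcost b s + t) s'"
| WhileFalse: "\<not> bval b s \<Longrightarrow> exec (While b c) s (bcost b s) s"
| WhileTrue: "bval b s \<Longrightarrow> exec c s t s' \<Longrightarrow> exec (While b c) s' t' s'' \<Longrightarrow>
    exec (While b c) s (bcost b s + t + t') s''"


section \<open>Polynomial-time scheduling algorithms\<close>

text \<open>The input of an algorithm consists of \<open>m\<close>, \<open>n\<close>, the rational matrix \<open>q\<close> of processing
  times and the rational parameters \<open>T\<close>, \<open>L\<close>. Rationals are given by numerator and denominator
  in lowest terms, and the matrix is stored row by row.\<close>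

definition input_size :: "nat \<Rightarrow> nat \<Rightarrow> (nat \<Rightarrow> nat \<Rightarrow> rat) \<Rightarrow> rat \<Rightarrow> rat \<Rightarrow> nat" where
  "input_size m n q T L =
     (let rat_size = (\<lambda>r. bit_length (fst (quotient_of r)) + bit_length (snd (quotient_of r)))
      in bit_length (int m) + bit_length (int n) +
         (\<Sum>i<m. \<Sum>j<n. rat_size (q i j)) + rat_size T + rat_size L)"

definition scalar :: "int \<Rightarrow> int \<Rightarrow> int" where
  "scalar v = (\<lambda>_. 0)(0 := v)"

definition matrix :: "nat \<Rightarrow> nat \<Rightarrow> (nat \<Rightarrow> nat \<Rightarrow> int) \<Rightarrow> int \<Rightarrow> int" where
  "matrix m n v = (\<lambda>k. if 0 \<le> k \<and> k < int (m * n) then v (nat k div n) (nat k mod n) else 0)"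

definition input_state :: "nat \<Rightarrow> nat \<Rightarrow> (nat \<Rightarrow> nat \<Rightarrow> rat) \<Rightarrow> rat \<Rightarrow> rat \<Rightarrow> state" where
  "input_state m n q T L = (\<lambda>_ _. 0)
     (''m'' := scalar (int m),
      ''n'' := scalar (int n),
      ''p_num'' := matrix m n (\<lambda>i j. fst (quotient_of (q i j))),
      ''p_den'' := matrix m n (\<lambda>i j. snd (quotient_of (q i j))),
      ''T_num'' := scalar (fst (quotient_of T)),
      ''T_den'' := scalar (snd (quotient_of T)),
      ''L_num'' := scalar (fst (quotient_of L)),
      ''L_den'' := scalar (snd (quotient_of L)))"

definition outputs ::
  "com \<Rightarrow> nat \<Rightarrow> nat \<Rightarrow> (nat \<Rightarrow> nat \<Rightarrow> rat) \<Rightarrow> rat \<Rightarrow> rat \<Rightarrow> (nat \<Rightarrow> nat) \<Rightarrow> bool" where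
  "outputs c m n q T L \<alpha> \<longleftrightarrow>
     (\<exists>t s. exec c (input_state m n q T L) t s \<and> (\<forall>j<n. s ''alpha'' (int j) = int (\<alpha> j)))"

text \<open>The time bound is required on all inputs, not only on those whose linear program is
  feasible.\<close>

definition polynomial_time :: "com \<Rightarrow> bool" where
  "polynomial_time c \<longleftrightarrow>
     (\<exists>b :: nat poly. \<forall>m n q T L.
        is_instance m n (\<lambda>i j. real_of_rat (q i j)) \<and> 0 < T \<and> 0 < L \<and> L \<le> T \<longrightarrow>
        (\<exists>t s. exec c (input_state m n q T L) t s \<and> t \<le> poly b (input_size m n q T L)))"

end

theory Submission imports Defs begin

text \<open>
  No linear program is solved. Instead an auction keeps a price \<open>l i + m + 1\<close> per machine and places
  every job \<open>j\<close> on a legal machine with (almost) least \<open>(l i + m + 1) * p i j\<close>. Call a machine irreparable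
  if its load exceeds \<open>T + min (L / h) T\<close> and still exceeds \<open>T\<close> after the removal of any single job. On an
  irreparable machine, a job that is cheaper elsewhere is moved to its cheapest machine; if there is
  none, the price of the machine is raised by one. Machines with a raised price keep load at least
  \<open>T\<close>, so weak LP duality applied to the prices gives
  \<open>(\<Sum>i. l i * (load i - T)) + m * (\<Sum>i. load i) \<le> (m + 1) * m * L\<close>. Hence the prices stay polynomially
  bounded, the auction stops after polynomially many steps, and the total load is then at most
  \<open>(m + 1) * L\<close>.

  After the auction all loads are at most \<open>2 * T\<close>. A machine loaded above \<open>T + L / h\<close> (when \<open>L / h < T\<close>)
  gives one suitable job to a legal machine of load at most \<open>L / h\<close>. By Markov's inequality, the number of
  machines loaded above \<open>L / h\<close> plus the number of those loaded above \<open>T + L / h\<close> is at most \<open>h * m\<close>, and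
  each such move preserves this, so a receiving machine always exists.

  The integer data of the program are the rational data multiplied by the product of all
  denominators, which has at most as many bits as the input.
\<close>

section \<open>Running time of bounded programs\<close>

text \<open>Integral prices give only approximate dual optimality: when the price of a machine rises
  by one, the jobs on it may become misplaced. Hence \<open>inv\<close> compares the factor
  \<open>l + m\<close> on a job's own machine with \<open>l + m + 1\<close> on all machines, and the
  dual variable \<open>m + 1\<close> of the budget constraint keeps this error small: the total load
  may exceed the budget \<open>m * L\<close> by the factor \<open>(m + 1) / m\<close> at most.
  Nothing is lost in the end, because the Markov count is an integer below
  \<open>H * (m + 1) / m <= H + 1\<close>, by \<open>H <= m\<close>.

  The price bound rests on \<open>h <= 1\<close>: an irreparable machine exceeds \<open>T\<close> by
  more than \<open>min (L / h) T >= L\<close>, so a price increment of \<open>(m + 1) * m\<close> on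
  it would overdraw the right-hand side of the duality inequality. Irreparability asks for load
  above \<open>T\<close> after the loss of any job because complementary slackness of the raised
  machines must survive every move of the auction.

  The time bound also concerns infeasible linear programs, for which none of this holds. So every
  loop has an iteration count fixed in advance, all size bounds are proved without duality, and
  correctness is carried along as an implication from \<open>feasible\<close>.\<close>

definition bounded :: "nat \<Rightarrow> state \<Rightarrow> bool" where
  "bounded X s \<longleftrightarrow> (\<forall>x k. \<bar>s x k\<bar> < 2 ^ X)"

lemma bit_length_le: "\<bar>v\<bar> < 2 ^ b \<Longrightarrow> bit_length v \<le> b + 1"
proof -
  assume "\<bar>v\<bar> < 2 ^ b"
  hence "nat \<bar>v\<bar> < 2 ^ b" by (simp add: nat_less_iff)
  hence "floorlog 2 (nat \<bar>v\<bar>) \<le> b" by (simp add: floorlog_le_iff)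
  thus ?thesis by (simp add: bit_length_def)
qed

lemma abs_less_bit_length: "\<bar>v\<bar> < 2 ^ bit_length v"
proof -
  have "nat \<bar>v\<bar> < 2 ^ floorlog 2 (nat \<bar>v\<bar>)"
    using floorlog_bounds[of "nat \<bar>v\<bar>" 2] by (cases "v = 0") (auto simp: floorlog_def)
  also have "\<dots> \<le> 2 ^ bit_length v" by (simp add: bit_length_def)
  finally show ?thesis by (simp add: nat_less_iff)
qed

text \<open>A loaded value weighs one word whatever its address, since the whole memory is bounded.
  Words have \<open>X + 1\<close> bits in \<open>abs_aval_less\<close>, which keeps all exponents
  positive even for \<open>X = 0\<close>, so that sums can be estimated like products.\<close>

fun value_weight :: "aexp \<Rightarrow> nat" where
  "value_weight (Const k) = bit_length k"
| "value_weight (Load x a) = 1"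
| "value_weight (Add a b) = value_weight a + value_weight b"
| "value_weight (Sub a b) = value_weight a + value_weight b"
| "value_weight (Mul a b) = value_weight a + value_weight b"
| "value_weight (Div a b) = value_weight a + value_weight b"

lemma value_weight_pos: "0 < value_weight a"
  by (induction a) (auto simp: bit_length_def)

text \<open>An instance of \<open>a + b <= a * b\<close> for \<open>a, b >= 2\<close>.\<close>

lemma two_power_add_le: "0 < u \<Longrightarrow> 0 < v \<Longrightarrow> (2::int) ^ u + 2 ^ v \<le> 2 ^ (u + v)"
proof -
  assume "0 < u" "0 < v"
  hence "(2::int) ^ 1 \<le> 2 ^ u" "(2::int) ^ 1 \<le> 2 ^ v" by (intro power_increasing; simp)+
  hence "0 \<le> (2 ^ u - 2) * ((2::int) ^ v - 2) + (2 ^ u - 2) + (2 ^ v - 2)"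
    by (intro add_nonneg_nonneg mult_nonneg_nonneg) auto
  thus ?thesis by (simp add: power_add algebra_simps)
qed

lemma abs_div_le: "\<bar>(a::int) div b\<bar> \<le> \<bar>a\<bar>"
proof (cases "b = 0")
  case False
  have pos: "\<bar>a div b\<bar> \<le> \<bar>a\<bar>" if "b > 0" for a b :: int
  proof (cases "a \<ge> 0")
    case True
    thus ?thesis using that zdiv_mono2[of a 1 b] by (simp add: pos_imp_zdiv_nonneg_iff)
  next
    case False
    have "a \<le> a div b" using zdiv_mono2_neg[of a 1 b] that False by simp
    moreover have "a div b < 0" using False that by (simp add: neg_imp_zdiv_neg_iff div_neg_pos_less0)
    ultimately show ?thesis using False by simp
  qed
  show ?thesis
  proof (cases "b > 0")
    case False
    with \<open>b \<noteq> 0\<close> have "\<bar>(-a) div (-b)\<bar> \<le> \<bar>-a\<bar>" by (intro pos) auto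
    thus ?thesis by simp
  qed (rule pos)
qed simp

lemma abs_aval_less:
  assumes "bounded X s"
  shows "\<bar>aval a s\<bar> < 2 ^ (value_weight a * (X + 1))"
proof (induction a)
  case (Const k)
  have "\<bar>k\<bar> < 2 ^ bit_length k" by (rule abs_less_bit_length)
  also have "\<dots> \<le> 2 ^ (bit_length k * (X + 1))" by (intro power_increasing) auto
  finally show ?case by simp
next
  case (Load x a)
  have "\<bar>s x (aval a s)\<bar> < 2 ^ X" using assms by (simp add: bounded_def)
  also have "(2::int) ^ X \<le> 2 ^ (X + 1)" by (intro power_increasing) auto
  finally show ?case by simp
next
  case (Add a b)
  have "(2::int) ^ (value_weight a * (X + 1)) + 2 ^ (value_weight b * (X + 1))
      \<le> 2 ^ (value_weight (Add a b) * (X + 1))"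
    using two_power_add_le[of "value_weight a * (X + 1)" "value_weight b * (X + 1)"]
      value_weight_pos[of a] value_weight_pos[of b] by (simp add: algebra_simps)
  with Add show ?case by (simp only: aval.simps)
next
  case (Sub a b)
  have "(2::int) ^ (value_weight a * (X + 1)) + 2 ^ (value_weight b * (X + 1))
      \<le> 2 ^ (value_weight (Sub a b) * (X + 1))"
    using two_power_add_le[of "value_weight a * (X + 1)" "value_weight b * (X + 1)"]
      value_weight_pos[of a] value_weight_pos[of b] by (simp add: algebra_simps)
  with Sub show ?case by (simp only: aval.simps)
next
  case (Mul a b)
  have "\<bar>aval a s\<bar> * \<bar>aval b s\<bar> < 2 ^ (value_weight a * (X + 1)) * 2 ^ (value_weight b * (X + 1))"
    by (rule mult_strict_mono') (use Mul in auto)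
  thus ?case by (simp add: abs_mult add_mult_distrib power_add mult_ac distrib_left)
next
  case (Div a b)
  have "\<bar>aval a s div aval b s\<bar> \<le> \<bar>aval a s\<bar>" by (rule abs_div_le)
  also note Div(1)
  also have "(2::int) ^ (value_weight a * (X + 1)) \<le> 2 ^ (value_weight (Div a b) * (X + 1))"
    by (intro power_increasing) (auto simp: add_mult_distrib)
  finally show ?case by simp
qed

text \<open>The \<open>+ 1\<close> at an arithmetic node pays for the additive constant in
  \<open>bit_length_le\<close>.\<close>

fun acost_weight :: "aexp \<Rightarrow> nat" where
  "acost_weight (Const k) = bit_length k"
| "acost_weight (Load x a) = acost_weight a + 1"
| "acost_weight (Add a b) = acost_weight a + acost_weight b + value_weight (Add a b) + 1"
| "acost_weight (Sub a b) = acost_weight a + acost_weight b + value_weight (Sub a b) + 1"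
| "acost_weight (Mul a b) = acost_weight a + acost_weight b + value_weight (Mul a b) + 1"
| "acost_weight (Div a b) = acost_weight a + acost_weight b + value_weight (Div a b) + 1"

lemma acost_le:
  assumes "bounded X s"
  shows "acost a s \<le> acost_weight a * (X + 1)"
proof (induction a)
  case (Load x a)
  have "bit_length (s x (aval a s)) \<le> X + 1"
    using assms by (intro bit_length_le) (simp add: bounded_def)
  with Load show ?case by simp
next
  case (Add a b)
  have "bit_length (aval (Add a b) s) \<le> value_weight (Add a b) * (X + 1) + 1"
    using abs_aval_less[OF assms] by (rule bit_length_le)
  with Add show ?case by (simp add: algebra_simps)
next
  case (Sub a b)
  have "bit_length (aval (Sub a b) s) \<le> value_weight (Sub a b) * (X + 1) + 1"
    using abs_aval_less[OF assms] by (rule bit_length_le)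
  with Sub show ?case by (simp add: algebra_simps)
next
  case (Mul a b)
  have "bit_length (aval (Mul a b) s) \<le> value_weight (Mul a b) * (X + 1) + 1"
    using abs_aval_less[OF assms] by (rule bit_length_le)
  with Mul show ?case by (simp add: algebra_simps)
next
  case (Div a b)
  have "bit_length (aval (Div a b) s) \<le> value_weight (Div a b) * (X + 1) + 1"
    using abs_aval_less[OF assms] by (rule bit_length_le)
  with Div show ?case by (simp add: algebra_simps)
qed simp

fun bcost_weight :: "bexp \<Rightarrow> nat" where
  "bcost_weight (Less a b) = 1 + acost_weight a + acost_weight b"
| "bcost_weight (Equal a b) = 1 + acost_weight a + acost_weight b"
| "bcost_weight (Neg b) = 1 + bcost_weight b"
| "bcost_weight (Conj b c) = 1 + bcost_weight b + bcost_weight c"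

lemma bcost_le:
  assumes "bounded X s"
  shows "bcost b s \<le> bcost_weight b * (X + 1)"
proof (induction b)
  case (Less a b)
  show ?case using acost_le[OF assms, of a] acost_le[OF assms, of b] by (simp add: algebra_simps)
next
  case (Equal a b)
  show ?case using acost_le[OF assms, of a] acost_le[OF assms, of b] by (simp add: algebra_simps)
qed (auto simp: algebra_simps)

text \<open>Bounds the running time of a program in which every stored value stays below \<open>2 ^ X\<close> and
  every loop is iterated at most \<open>X\<close> times.\<close>

fun time_bound :: "nat \<Rightarrow> com \<Rightarrow> nat" where
  "time_bound X Skip = 1"
| "time_bound X (Store x a b) = 1 + (acost_weight a + acost_weight b) * (X + 1)"
| "time_bound X (Seq c d) = time_bound X c + time_bound X d"
| "time_bound X (If b c d) = bcost_weight b * (X + 1) + time_bound X c + time_bound X d"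
| "time_bound X (While b c) = X * (bcost_weight b * (X + 1) + time_bound X c) + bcost_weight b * (X + 1)"

lemma time_bound_poly: "\<exists>f :: nat poly. \<forall>X. time_bound X c = poly f X"
proof (induction c)
  case Skip
  show ?case by (rule exI[of _ "[:1:]"]) simp
next
  case (Store x a b)
  show ?case by (rule exI[of _ "1 + [:acost_weight a + acost_weight b:] * [:1, 1:]"]) simp
next
  case (Seq c d)
  then obtain f g where "\<forall>X. time_bound X c = poly f X" "\<forall>X. time_bound X d = poly g X" by blast
  thus ?case by (intro exI[of _ "f + g"]) simp
next
  case (If b c d)
  then obtain f g where "\<forall>X. time_bound X c = poly f X" "\<forall>X. time_bound X d = poly g X" by blast
  thus ?case by (intro exI[of _ "[:bcost_weight b:] * [:1, 1:] + f + g"]) simp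
next
  case (While b c)
  then obtain f where "\<forall>X. time_bound X c = poly f X" by blast
  thus ?case
    by (intro exI[of _ "[:0, 1:] * ([:bcost_weight b:] * [:1, 1:] + f) + [:bcost_weight b:] * [:1, 1:]"])
      (simp add: algebra_simps)
qed

section \<open>Rules for total correctness with a built-in time bound\<close>

definition wp :: "nat \<Rightarrow> com \<Rightarrow> (state \<Rightarrow> bool) \<Rightarrow> state \<Rightarrow> bool" where
  "wp X c Q s \<longleftrightarrow> (bounded X s \<longrightarrow>
     (\<exists>t s'. exec c s t s' \<and> t \<le> time_bound X c \<and> bounded X s' \<and> Q s'))"

lemma wp_Skip: "Q s \<Longrightarrow> wp X Skip Q s"
  unfolding wp_def using exec.Skip by fastforce

text \<open>This is the only rule with a size condition, and it concerns the stored value alone: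
  addresses and intermediate results may exceed \<open>2 ^ X\<close>, their cost being covered by
  \<open>acost_le\<close>.\<close>

lemma wp_Store:
  assumes "\<bar>aval b s\<bar> < 2 ^ X" and "Q (s(x := (s x)(aval a s := aval b s)))"
  shows "wp X (Store x a b) Q s"
  unfolding wp_def
proof (intro impI exI conjI)
  assume "bounded X s"
  show "exec (Store x a b) s (1 + acost a s + acost b s) (s(x := (s x)(aval a s := aval b s)))"
    by (rule exec.Store)
  show "1 + acost a s + acost b s \<le> time_bound X (Store x a b)"
    using acost_le[OF \<open>bounded X s\<close>, of a] acost_le[OF \<open>bounded X s\<close>, of b]
    by (simp add: algebra_simps)
  show "bounded X (s(x := (s x)(aval a s := aval b s)))"
    using \<open>bounded X s\<close> assms(1) by (auto simp: bounded_def)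
qed (rule assms(2))

lemma wp_Seq: "wp X c (wp X d Q) s \<Longrightarrow> wp X (Seq c d) Q s"
  unfolding wp_def time_bound.simps by (meson exec.Seq add_mono)

lemma wp_If:
  assumes "bval b s \<Longrightarrow> wp X c Q s" and "\<not> bval b s \<Longrightarrow> wp X d Q s"
  shows "wp X (If b c d) Q s"
  unfolding wp_def
proof
  assume bd: "bounded X s"
  note cost = bcost_le[OF bd, of b]
  show "\<exists>t s'. exec (If b c d) s t s' \<and> t \<le> time_bound X (If b c d) \<and> bounded X s' \<and> Q s'"
  proof (cases "bval b s")
    case True
    then obtain t s' where "exec c s t s'" "t \<le> time_bound X c" "bounded X s'" "Q s'"
      using assms(1) bd by (auto simp: wp_def)
    moreover have "bcost b s + t \<le> time_bound X (If b c d)" using cost calculation(2) by simp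
    ultimately show ?thesis using exec.IfTrue[OF True] by blast
  next
    case False
    then obtain t s' where "exec d s t s'" "t \<le> time_bound X d" "bounded X s'" "Q s'"
      using assms(2) bd by (auto simp: wp_def)
    moreover have "bcost b s + t \<le> time_bound X (If b c d)" using cost calculation(2) by simp
    ultimately show ?thesis using exec.IfFalse[OF False] by blast
  qed
qed

lemma wp_mono: "wp X c Q s \<Longrightarrow> (\<And>s'. Q s' \<Longrightarrow> R s') \<Longrightarrow> wp X c R s"
  unfolding wp_def by blast

fun modified :: "com \<Rightarrow> vname set" where
  "modified Skip = {}"
| "modified (Store x a b) = {x}"
| "modified (Seq c d) = modified c \<union> modified d"
| "modified (If b c d) = modified c \<union> modified d"
| "modified (While b c) = modified c"

lemma exec_unmodified: "exec c s t s' \<Longrightarrow> z \<notin> modified c \<Longrightarrow> s' z = s z"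
  by (induction rule: exec.induct) auto

text \<open>Allows specifications of subprograms to be silent about variables that are not
  written.\<close>

lemma wp_frame:
  assumes "wp X c Q s"
  shows "wp X c (\<lambda>s'. Q s' \<and> (\<forall>z. z \<notin> modified c \<longrightarrow> s' z = s z)) s"
  using assms unfolding wp_def by (meson exec_unmodified)

text \<open>The index of the invariant is the iteration count. It replaces a termination measure,
  and \<open>N <= X\<close> makes the total cost fit into \<open>time_bound\<close>.\<close>

lemma wp_While:
  assumes "k \<le> N" and "N \<le> X"
    and "I k s"
    and "\<And>k s. k < N \<Longrightarrow> I k s \<Longrightarrow> bval b s \<and> wp X c (I (Suc k)) s"
    and "\<And>s. I N s \<Longrightarrow> \<not> bval b s \<and> Q s"
  shows "wp X (While b c) Q s"
proof -
  have "bounded X s \<longrightarrow> (\<exists>t s'. exec (While b c) s t s' \<and>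
      t \<le> (N - k) * (bcost_weight b * (X + 1) + time_bound X c) + bcost_weight b * (X + 1)
      \<and> bounded X s' \<and> Q s')"
    using assms(1,3)
  proof (induction "N - k" arbitrary: k s)
    case 0
    hence "I N s" by simp
    hence "\<not> bval b s" "Q s" using assms(5) by auto
    thus ?case using exec.WhileFalse bcost_le[of X s b]
      by (metis add_increasing zero_le)
  next
    case (Suc d)
    show ?case
    proof
      assume bd: "bounded X s"
      have "k < N" using Suc by simp
      from assms(4)[OF this \<open>I k s\<close>] bd obtain t1 s1 where b: "bval b s" and
        1: "exec c s t1 s1" "t1 \<le> time_bound X c" "bounded X s1" "I (Suc k) s1" by (auto simp: wp_def)
      have "d = N - Suc k" "Suc k \<le> N" using Suc \<open>k < N\<close> by auto
      from Suc(1)[OF this 1(4)] 1(3) obtain t2 s2 where 2: "exec (While b c) s1 t2 s2"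
        "t2 \<le> (N - Suc k) * (bcost_weight b * (X + 1) + time_bound X c) + bcost_weight b * (X + 1)"
        "bounded X s2" "Q s2" by auto
      have "N - k = Suc (N - Suc k)" using \<open>k < N\<close> by simp
      hence "bcost b s + t1 + t2 \<le>
        (N - k) * (bcost_weight b * (X + 1) + time_bound X c) + bcost_weight b * (X + 1)"
        using bcost_le[OF bd, of b] 1(2) 2(2) by simp
      thus "\<exists>t s'. exec (While b c) s t s' \<and>
        t \<le> (N - k) * (bcost_weight b * (X + 1) + time_bound X c) + bcost_weight b * (X + 1)
        \<and> bounded X s' \<and> Q s'"
        using exec.WhileTrue[OF b 1(1) 2(1)] 2(3,4) by blast
    qed
  qed
  moreover have "(N - k) * (bcost_weight b * (X + 1) + time_bound X c) \<le>
      X * (bcost_weight b * (X + 1) + time_bound X c)"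
    using assms(2) by (intro mult_right_mono) auto
  ultimately show ?thesis unfolding wp_def time_bound.simps by (meson add_mono le_refl order_trans)
qed

abbreviation Var :: "vname \<Rightarrow> aexp" where
  "Var x \<equiv> Load x (Const 0)"

abbreviation Assign :: "vname \<Rightarrow> aexp \<Rightarrow> com" where
  "Assign x a \<equiv> Store x (Const 0) a"

definition For :: "vname \<Rightarrow> aexp \<Rightarrow> com \<Rightarrow> com" where
  "For x a c = Seq (Assign x (Const 0))
     (While (Less (Var x) a) (Seq c (Assign x (Add (Var x) (Const 1)))))"

lemma modified_For [simp]: "modified (For x a c) = insert x (modified c)"
  by (simp add: For_def)

text \<open>Quantifying over the contents \<open>f\<close> of the counter array forces the invariant
  to ignore the counter, so that its initialization and increment are treated here once. The limit
  is re-evaluated in every round, hence \<open>bound\<close> lets it depend only on what the loop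
  leaves unchanged.\<close>

lemma wp_For:
  assumes "x \<notin> modified c" and "N \<le> X"
    and bound: "\<And>s'. (\<And>z. z \<notin> insert x (modified c) \<Longrightarrow> s' z = s z) \<Longrightarrow> aval a s' = int N"
    and init: "\<And>f. I 0 (s(x := f))"
    and step: "\<And>k s'. k < N \<Longrightarrow> s' x 0 = int k \<Longrightarrow>
      (\<And>z. z \<notin> insert x (modified c) \<Longrightarrow> s' z = s z) \<Longrightarrow> I k s' \<Longrightarrow>
      wp X c (\<lambda>s''. \<forall>f. I (Suc k) (s''(x := f))) s'"
    and final: "\<And>s'. (\<And>z. z \<notin> insert x (modified c) \<Longrightarrow> s' z = s z) \<Longrightarrow> I N s' \<Longrightarrow> Q s'"
  shows "wp X (For x a c) Q s"
proof -
  define J where "J k s' \<longleftrightarrow> s' x 0 = int k \<and>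
    (\<forall>z. z \<notin> insert x (modified c) \<longrightarrow> s' z = s z) \<and> I k s'" for k s'
  show ?thesis unfolding For_def
  proof (intro wp_Seq wp_Store)
    show "wp X (While (Less (Var x) a) (Seq c (Assign x (Add (Var x) (Const 1))))) Q
      (s(x := (s x)(aval (Const 0) s := aval (Const 0) s)))"
    proof (rule wp_While[where I = J, OF _ \<open>N \<le> X\<close>])
      show "J 0 (s(x := (s x)(aval (Const 0) s := aval (Const 0) s)))"
        using init by (simp add: J_def)
      fix k s'
      assume "k < N" and J: "J k s'"
      hence "bval (Less (Var x) a) s'" using bound[of s'] by (simp add: J_def)
      moreover have "wp X c (\<lambda>s''. \<forall>f. I (Suc k) (s''(x := f))) s'"
        using J by (intro step) (auto simp: J_def \<open>k < N\<close>)
      note wp_frame[OF this]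
      hence "wp X (Seq c (Assign x (Add (Var x) (Const 1)))) (J (Suc k)) s'"
      proof (rule wp_Seq[OF wp_mono], goal_cases)
        case (1 s'')
        have "s'' x 0 = int k" using 1 assms(1) J by (simp add: J_def)
        moreover have "int (Suc k) < 2 ^ X"
          using \<open>k < N\<close> \<open>N \<le> X\<close> by (metis le_less_trans less_exp of_nat_less_numeral_power_cancel_iff Suc_leI order_trans)
        moreover have "s'' z = s z" if "z \<notin> insert x (modified c)" for z
          using that 1 J by (simp add: J_def)
        ultimately show ?case using 1 by (intro wp_Store) (auto simp: J_def)
      qed
      ultimately show "bval (Less (Var x) a) s' \<and>
        wp X (Seq c (Assign x (Add (Var x) (Const 1)))) (J (Suc k)) s'" by blast
    next
      fix s'
      assume J: "J N s'"
      show "\<not> bval (Less (Var x) a) s' \<and> Q s'"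
        using J bound[of s'] final[of s'] by (auto simp: J_def)
    qed simp
  qed simp
qed

section \<open>The auction and its repair phase\<close>

text \<open>A polymorphic version of \<open>load\<close>: the program computes with integers, the
  theorem speaks of reals, and the combinatorial argument serves both.\<close>

definition machine_load :: "nat \<Rightarrow> (nat \<Rightarrow> nat \<Rightarrow> 'a::comm_monoid_add) \<Rightarrow> (nat \<Rightarrow> nat) \<Rightarrow> nat \<Rightarrow> 'a" where
  "machine_load n p \<alpha> i = (\<Sum>j | j < n \<and> \<alpha> j = i. p i j)"

lemma machine_load_alt: "machine_load n p \<alpha> i = (\<Sum>j<n. if \<alpha> j = i then p i j else 0)"
proof -
  have "{j. j < n \<and> \<alpha> j = i} = {..<n} \<inter> {j. \<alpha> j = i}" by auto
  thus ?thesis by (simp add: machine_load_def sum.If_cases)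
qed

lemma machine_load_move:
  fixes p :: "nat \<Rightarrow> nat \<Rightarrow> 'a::ab_group_add"
  assumes "j < n"
  shows "machine_load n p (\<alpha>(j := b)) i =
    machine_load n p \<alpha> i - (if i = \<alpha> j then p i j else 0) + (if i = b then p i j else 0)"
proof -
  have "machine_load n p \<beta> i = (if \<beta> j = i then p i j else 0) +
      (\<Sum>k\<in>{..<n} - {j}. if \<beta> k = i then p i k else 0)" for \<beta>
    unfolding machine_load_alt using assms by (subst sum.remove[of _ j]) auto
  from this[of \<alpha>] this[of "\<alpha>(j := b)"] show ?thesis
    by (auto simp: algebra_simps intro!: sum.cong)
qed

lemma sum_machine_load:
  fixes p :: "nat \<Rightarrow> nat \<Rightarrow> 'a::comm_ring_1"
  assumes "\<forall>j<n. \<alpha> j < m"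
  shows "(\<Sum>i<m. c i * machine_load n p \<alpha> i) = (\<Sum>j<n. c (\<alpha> j) * p (\<alpha> j) j)"
proof -
  have "(\<Sum>i<m. c i * machine_load n p \<alpha> i) = (\<Sum>j<n. \<Sum>i<m. c i * (if \<alpha> j = i then p i j else 0))"
    unfolding machine_load_alt sum_distrib_left by (rule sum.swap)
  also have "\<dots> = (\<Sum>j<n. c (\<alpha> j) * p (\<alpha> j) j)"
  proof (rule sum.cong[OF refl])
    fix j
    assume "j \<in> {..<n}"
    hence "\<alpha> j < m" using assms by simp
    have "(\<Sum>i<m. c i * (if \<alpha> j = i then p i j else 0)) = (\<Sum>i<m. if \<alpha> j = i then c i * p i j else 0)"
      by (intro sum.cong) auto
    also have "\<dots> = c (\<alpha> j) * p (\<alpha> j) j" using \<open>\<alpha> j < m\<close> by simp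
    finally show "(\<Sum>i<m. c i * (if \<alpha> j = i then p i j else 0)) = c (\<alpha> j) * p (\<alpha> j) j" .
  qed
  finally show ?thesis .
qed

lemma machine_load_nonneg:
  fixes p :: "nat \<Rightarrow> nat \<Rightarrow> 'a::ordered_comm_monoid_add"
  assumes "\<forall>i<m. \<forall>j<n. 0 \<le> p i j" "i < m"
  shows "0 \<le> machine_load n p \<alpha> i"
  unfolding machine_load_def by (intro sum_nonneg) (use assms in auto)

section \<open>Approximate complementary slackness and termination of the auction\<close>

definition job_price :: "nat \<Rightarrow> (nat \<Rightarrow> nat \<Rightarrow> 'a::comm_semiring_1) \<Rightarrow> (nat \<Rightarrow> nat) \<Rightarrow> nat \<Rightarrow> nat \<Rightarrow> 'a" where
  "job_price m p l i j = of_nat (l i + m + 1) * p i j"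

definition overfull ::
  "nat \<Rightarrow> (nat \<Rightarrow> nat \<Rightarrow> 'a::linordered_idom) \<Rightarrow> 'a \<Rightarrow> nat \<Rightarrow> 'a \<Rightarrow> (nat \<Rightarrow> nat) \<Rightarrow> nat \<Rightarrow> bool" where
  "overfull n p T H M \<alpha> i \<longleftrightarrow> M < of_nat H * (machine_load n p \<alpha> i - T)"

definition irreparable ::
  "nat \<Rightarrow> (nat \<Rightarrow> nat \<Rightarrow> 'a::linordered_idom) \<Rightarrow> 'a \<Rightarrow> nat \<Rightarrow> 'a \<Rightarrow> (nat \<Rightarrow> nat) \<Rightarrow> nat \<Rightarrow> bool" where
  "irreparable n p T H M \<alpha> i \<longleftrightarrow> overfull n p T H M \<alpha> i \<and>
     (\<forall>j<n. \<alpha> j = i \<longrightarrow> T < machine_load n p \<alpha> i - p i j)"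

definition optimally_placed ::
  "nat \<Rightarrow> (nat \<Rightarrow> nat \<Rightarrow> 'a::linordered_idom) \<Rightarrow> 'a \<Rightarrow> (nat \<Rightarrow> nat) \<Rightarrow> (nat \<Rightarrow> nat) \<Rightarrow> nat \<Rightarrow> bool" where
  "optimally_placed m p T \<alpha> l j \<longleftrightarrow>
     (\<forall>i<m. p i j \<le> T \<longrightarrow> job_price m p l (\<alpha> j) j \<le> job_price m p l i j)"

text \<open>Machine \<open>i\<close> carries the price \<open>l i + m + 1\<close>. The assumption \<open>dual\<close> is the part of LP duality
  that a feasible solution provides: \<open>c\<close> and \<open>l\<close> are dual variables for the jobs and the machines,
  and the dual variable of the budget constraint is fixed to \<open>m + 1\<close>.\<close>

locale feasible_scheduling =
  fixes m n :: nat and p :: "nat \<Rightarrow> nat \<Rightarrow> 'a::linordered_idom" and T L :: 'a and H :: nat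
  assumes p_nonneg: "\<forall>i<m. \<forall>j<n. 0 \<le> p i j"
    and T_pos: "0 < T" and L_pos: "0 < L" and L_le_T: "L \<le> T"
    and H_pos: "0 < H" and H_le: "H \<le> m"
    and legal_card: "\<forall>j<n. H \<le> card {i. i < m \<and> p i j \<le> T}"
    and dual: "\<And>(l :: nat \<Rightarrow> nat) c.
      \<forall>i<m. \<forall>j<n. p i j \<le> T \<longrightarrow> c j \<le> of_nat (l i + m + 1) * p i j \<Longrightarrow>
      (\<Sum>j<n. c j) \<le> T * (\<Sum>i<m. of_nat (l i)) + of_nat (m + 1) * of_nat m * L"
begin

abbreviation ld :: "(nat \<Rightarrow> nat) \<Rightarrow> nat \<Rightarrow> 'a" where
  "ld \<equiv> machine_load n p"

abbreviation price :: "(nat \<Rightarrow> nat) \<Rightarrow> nat \<Rightarrow> nat \<Rightarrow> 'a" where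
  "price \<equiv> job_price m p"

text \<open>\<open>H\<close> times the bound \<open>min (L / h) T\<close> on the excess over \<open>T\<close>, where \<open>h = H / m\<close>.\<close>

definition slack :: 'a where
  "slack = min (L * of_nat m) (T * of_nat H)"

abbreviation over :: "(nat \<Rightarrow> nat) \<Rightarrow> nat \<Rightarrow> bool" where
  "over \<equiv> overfull n p T H slack"

abbreviation bad :: "(nat \<Rightarrow> nat) \<Rightarrow> nat \<Rightarrow> bool" where
  "bad \<equiv> irreparable n p T H slack"

abbreviation optimal :: "(nat \<Rightarrow> nat) \<Rightarrow> (nat \<Rightarrow> nat) \<Rightarrow> nat \<Rightarrow> bool" where
  "optimal \<equiv> optimally_placed m p T"

text \<open>Complementary slackness with tolerance: the second clause forgives one unit of price on
  the job's own machine, and the third lets a machine have a positive dual variable only if its load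
  reaches \<open>T\<close>. The last clause keeps the subtraction in \<open>potential\<close> from
  being truncated.\<close>

definition inv :: "(nat \<Rightarrow> nat) \<Rightarrow> (nat \<Rightarrow> nat) \<Rightarrow> bool" where
  "inv \<alpha> l \<longleftrightarrow>
     (\<forall>j<n. \<alpha> j < m \<and> p (\<alpha> j) j \<le> T) \<and>
     (\<forall>j<n. \<forall>i<m. p i j \<le> T \<longrightarrow> of_nat (l (\<alpha> j) + m) * p (\<alpha> j) j \<le> price l i j) \<and>
     (\<forall>i<m. 0 < l i \<longrightarrow> T \<le> ld \<alpha> i) \<and>
     (\<forall>i<m. l i \<le> (m + 1) * m)"

text \<open>A lexicographic measure coded as one number: a raise can make up to \<open>n\<close>
  jobs misplaced, and the factor \<open>n + 1\<close> outweighs them; a move leaves prices alone and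
  settles one job.\<close>

definition potential :: "(nat \<Rightarrow> nat) \<Rightarrow> (nat \<Rightarrow> nat) \<Rightarrow> nat" where
  "potential \<alpha> l = (m * ((m + 1) * m) - (\<Sum>i<m. l i)) * (n + 1) + card {j. j < n \<and> \<not> optimal \<alpha> l j}"

lemma m_pos: "0 < m" using H_pos H_le by simp

lemma slack_nonneg: "0 \<le> slack"
  using T_pos L_pos by (simp add: slack_def)

lemma ld_nonneg: "i < m \<Longrightarrow> 0 \<le> ld \<alpha> i"
  using machine_load_nonneg[OF p_nonneg] by simp

lemma over_load: "over \<alpha> i \<Longrightarrow> T < ld \<alpha> i"
  using slack_nonneg H_pos unfolding overfull_def
  by (metis diff_gt_0_iff_gt le_less_trans of_nat_0_less_iff zero_less_mult_pos)

text \<open>The job duals are the prices paid with one unit forgiven,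
  \<open>c j = (l (\<alpha> j) + m) * p (\<alpha> j) j\<close>; the second clause of
  \<open>inv\<close> is precisely their dual feasibility. Grouping their sum by machines gives the
  claim.\<close>

lemma weighted_load_le:
  assumes "inv \<alpha> l"
  shows "(\<Sum>i<m. of_nat (l i) * (ld \<alpha> i - T)) + of_nat m * (\<Sum>i<m. ld \<alpha> i)
    \<le> of_nat (m + 1) * of_nat m * L"
proof -
  have a: "\<forall>j<n. \<alpha> j < m" using assms by (simp add: inv_def)
  have "(\<Sum>j<n. of_nat (l (\<alpha> j) + m) * p (\<alpha> j) j)
      \<le> T * (\<Sum>i<m. of_nat (l i)) + of_nat (m + 1) * of_nat m * L"
    using assms by (intro dual) (auto simp: inv_def job_price_def)
  also have "(\<Sum>j<n. of_nat (l (\<alpha> j) + m) * p (\<alpha> j) j) = (\<Sum>i<m. of_nat (l i + m) * ld \<alpha> i)"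
    using sum_machine_load[OF a, where c = "\<lambda>i. of_nat (l i + m)" and p = p] by simp
  also have "\<dots> = (\<Sum>i<m. of_nat (l i) * (ld \<alpha> i - T)) + of_nat m * (\<Sum>i<m. ld \<alpha> i) +
      T * (\<Sum>i<m. of_nat (l i))"
    by (simp add: sum_distrib_left algebra_simps sum.distrib sum_subtractf)
  finally show ?thesis by simp
qed

lemma weighted_excess_nonneg:
  assumes "inv \<alpha> l" "i < m"
  shows "0 \<le> of_nat (l i) * (ld \<alpha> i - T)"
  using assms by (cases "l i = 0") (auto simp: inv_def)

lemma total_load_le:
  assumes "inv \<alpha> l"
  shows "(\<Sum>i<m. ld \<alpha> i) \<le> of_nat (m + 1) * L"
proof -
  have "0 \<le> (\<Sum>i<m. of_nat (l i) * (ld \<alpha> i - T))"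
    using weighted_excess_nonneg[OF assms] by (intro sum_nonneg) auto
  hence "of_nat m * (\<Sum>i<m. ld \<alpha> i) \<le> of_nat m * (of_nat (m + 1) * L)"
    using weighted_load_le[OF assms] by (simp add: algebra_simps)
  thus ?thesis using m_pos by (subst (asm) mult_le_cancel_left_pos) auto
qed

text \<open>Duality keeps the prices polynomially bounded: a machine whose price has become too high
  would have to be overfull by more than the budget allows.\<close>

lemma overfull_price_less:
  assumes "inv \<alpha> l" "u < m" "over \<alpha> u"
  shows "l u < (m + 1) * m"
proof (cases "l u = 0")
  case True
  thus ?thesis using m_pos by simp
next
  case False
  define e where "e = ld \<alpha> u - T"
  have e: "slack < of_nat H * e" "0 < e" using assms(3) over_load[OF assms(3)] by (auto simp: overfull_def e_def)
  have "of_nat (l u) * e \<le> (\<Sum>i<m. of_nat (l i) * (ld \<alpha> i - T))"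
    unfolding e_def using weighted_excess_nonneg[OF assms(1)] assms(2)
    by (intro member_le_sum) auto
  also have "\<dots> \<le> of_nat ((m + 1) * m) * L"
  proof -
    have "0 \<le> of_nat m * (\<Sum>i<m. ld \<alpha> i)" by (intro mult_nonneg_nonneg sum_nonneg) (auto simp: ld_nonneg)
    thus ?thesis using weighted_load_le[OF assms(1)] by (simp add: algebra_simps)
  qed
  finally have 1: "of_nat (l u) * e \<le> of_nat ((m + 1) * m) * L" .
  have "(of_nat (l u) :: 'a) < of_nat ((m + 1) * m)"
  \<comment> \<open>The excess \<open>e\<close> is larger than \<open>L\<close> in both cases: here
    \<open>e > T >= L\<close>, in the other case \<open>e > L * m / H >= L\<close>. So
    \<open>l u\<close> copies of it fit into \<open>(m + 1) * m * L\<close> only if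
    \<open>l u\<close> is below \<open>(m + 1) * m\<close>.\<close>
  proof (cases "slack = T * of_nat H")
    case True
    hence "of_nat H * T < of_nat H * e" using e by (simp add: mult.commute)
    hence "T < e" using H_pos by simp
    hence "of_nat (l u) * T < of_nat (l u) * e" using False by simp
    also note 1
    also have "of_nat ((m + 1) * m) * L \<le> of_nat ((m + 1) * m) * T"
      using L_le_T by (intro mult_left_mono) auto
    finally show ?thesis using mult_less_cancel_right_pos[OF T_pos] by blast
  next
    case False': False
    hence "slack = L * of_nat m" by (auto simp: slack_def min_def split: if_splits)
    hence "of_nat m * L < of_nat H * e" using e by (simp add: mult.commute)
    also have "\<dots> \<le> of_nat m * e" using H_le e(2) by (intro mult_right_mono) auto
    finally have "L < e" using m_pos by simp
    hence "of_nat (l u) * L < of_nat (l u) * e" using False by simp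
    also note 1
    finally show ?thesis using mult_less_cancel_right_pos[OF L_pos] by blast
  qed
  thus ?thesis by (simp only: of_nat_less_iff)
qed

lemma inv_init:
  assumes "\<forall>j<n. \<alpha> j < m \<and> p (\<alpha> j) j \<le> T" "\<forall>j<n. optimal \<alpha> (\<lambda>_. 0) j"
  shows "inv \<alpha> (\<lambda>_. 0)"
proof -
  have "of_nat m * p (\<alpha> j) j \<le> price (\<lambda>_. 0) i j" if "j < n" "i < m" "p i j \<le> T" for i j
  proof -
    have "of_nat m * p (\<alpha> j) j \<le> of_nat (m + 1) * p (\<alpha> j) j"
      using assms p_nonneg that by (intro mult_right_mono) auto
    also have "\<dots> \<le> price (\<lambda>_. 0) i j"
      using assms(2) that unfolding optimally_placed_def job_price_def by simp
    finally show ?thesis .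
  qed
  thus ?thesis using assms(1) by (simp add: inv_def)
qed

lemma potential_init: "potential \<alpha> (\<lambda>_. 0) \<le> m * ((m + 1) * m) * (n + 1) + n"
proof -
  have "card {j. j < n \<and> \<not> optimal \<alpha> (\<lambda>_. 0) j} \<le> card {..<n}" by (intro card_mono) auto
  thus ?thesis by (simp add: potential_def)
qed

text \<open>Irreparability leaves machine \<open>u\<close> above \<open>T\<close> even without
  \<open>j\<close>, and every other machine can only gain load, so the third clause of
  \<open>inv\<close> survives. Prices are unchanged, hence no other job changes its status while
  \<open>j\<close> becomes optimally placed.\<close>

lemma step_move:
  assumes "inv \<alpha> l" "u < m" "bad \<alpha> u" "j < n" "\<alpha> j = u" "b < m" "p b j \<le> T"
    and less: "price l b j < price l u j"
    and best: "\<forall>i<m. p i j \<le> T \<longrightarrow> price l b j \<le> price l i j"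
  shows "inv (\<alpha>(j := b)) l" and "potential (\<alpha>(j := b)) l < potential \<alpha> l"
proof -
  let ?\<beta> = "\<alpha>(j := b)"
  have "b \<noteq> u" using less by auto
  have legal: "\<forall>k<n. ?\<beta> k < m \<and> p (?\<beta> k) k \<le> T" using assms by (auto simp: inv_def)
  have "of_nat (l (?\<beta> k) + m) * p (?\<beta> k) k \<le> price l i k" if "k < n" "i < m" "p i k \<le> T" for i k
  proof (cases "k = j")
    case True
    have "of_nat (l b + m) * p b j \<le> of_nat (l b + m + 1) * p b j"
      using p_nonneg assms by (intro mult_right_mono) auto
    also have "\<dots> \<le> price l i j" using best that True by (auto simp: job_price_def)
    finally show ?thesis using True by simp
  next
    case False
    thus ?thesis using assms(1) that by (simp add: inv_def)
  qed
  moreover have "T \<le> ld ?\<beta> i" if "i < m" "0 < l i" for i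
  proof (cases "i = u")
    case True
    have "ld ?\<beta> u = ld \<alpha> u - p u j"
      using assms(4,5) \<open>b \<noteq> u\<close> by (simp add: machine_load_move)
    thus ?thesis using assms(3,4,5) True by (simp add: irreparable_def order_less_imp_le)
  next
    case False
    have "ld \<alpha> i \<le> ld ?\<beta> i"
      using False assms(4-6) p_nonneg by (simp add: machine_load_move)
    moreover have "T \<le> ld \<alpha> i" using assms(1) that by (simp add: inv_def)
    ultimately show ?thesis by simp
  qed
  ultimately show "inv ?\<beta> l" using legal assms(1) by (auto simp: inv_def simp del: fun_upd_apply)
  have "{k. k < n \<and> \<not> optimal ?\<beta> l k} \<subset> {k. k < n \<and> \<not> optimal \<alpha> l k}"
  proof
    have "optimal ?\<beta> l j" using best by (simp add: optimally_placed_def)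
    moreover have "optimal ?\<beta> l k = optimal \<alpha> l k" if "k \<noteq> j" for k
      using that by (simp add: optimally_placed_def)
    ultimately show "{k. k < n \<and> \<not> optimal ?\<beta> l k} \<subseteq> {k. k < n \<and> \<not> optimal \<alpha> l k}"
      by auto (metis)
    have "\<not> optimal \<alpha> l j" using less assms(4-7) by (auto simp: optimally_placed_def not_le)
    thus "{k. k < n \<and> \<not> optimal ?\<beta> l k} \<noteq> {k. k < n \<and> \<not> optimal \<alpha> l k}"
      using \<open>optimal ?\<beta> l j\<close> assms(4) by blast
  qed
  hence "card {k. k < n \<and> \<not> optimal ?\<beta> l k} < card {k. k < n \<and> \<not> optimal \<alpha> l k}"
    by (intro psubset_card_mono) auto
  thus "potential ?\<beta> l < potential \<alpha> l" by (simp add: potential_def)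
qed

text \<open>Optimality at the old price is exactly the tolerated error at the new one, because
  \<open>l u + m + 1 = (l u + 1) + m\<close>. This is why the increment is one and why every job on
  \<open>u\<close> must be optimally placed beforehand. Jobs elsewhere merely see a dearer
  alternative.\<close>

lemma step_raise:
  assumes "inv \<alpha> l" "u < m" "bad \<alpha> u"
    and opt: "\<forall>j<n. \<alpha> j = u \<longrightarrow> optimal \<alpha> l j"
  shows "inv \<alpha> (l(u := l u + 1))" and "potential \<alpha> (l(u := l u + 1)) < potential \<alpha> l"
proof -
  let ?l = "l(u := l u + 1)"
  have over: "over \<alpha> u" using assms(3) by (simp add: irreparable_def)
  have lu: "l u < (m + 1) * m" by (rule overfull_price_less[OF assms(1,2) over])
  have grow: "price l i k \<le> price ?l i k" if "i < m" "k < n" for i k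
    unfolding job_price_def using p_nonneg that by (intro mult_right_mono) auto
  have "of_nat (?l (\<alpha> k) + m) * p (\<alpha> k) k \<le> price ?l i k" if "k < n" "i < m" "p i k \<le> T" for i k
  proof (cases "\<alpha> k = u")
    case True
    have "of_nat (?l (\<alpha> k) + m) * p (\<alpha> k) k = price l (\<alpha> k) k"
      using True by (simp add: job_price_def)
    also have "\<dots> \<le> price l i k" using opt that True by (auto simp: optimally_placed_def)
    finally show ?thesis using grow[OF that(2,1)] by simp
  next
    case False
    hence "of_nat (?l (\<alpha> k) + m) * p (\<alpha> k) k \<le> price l i k"
      using assms(1) that by (simp add: inv_def)
    thus ?thesis using grow[OF that(2,1)] by simp
  qed
  thus "inv \<alpha> ?l" using assms(1) over_load[OF over] lu by (auto simp: inv_def)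
  have "(\<Sum>i<m. l i) < m * ((m + 1) * m)"
  proof -
    have "(\<Sum>i<m. l i) < (\<Sum>i<m. (m + 1) * m)"
      using assms(1,2) lu by (intro sum_strict_mono_ex1) (auto simp: inv_def)
    thus ?thesis by simp
  qed
  moreover have "(\<Sum>i<m. ?l i) = (\<Sum>i<m. l i) + 1"
  proof -
    have "(\<Sum>i<m. ?l i) = ?l u + (\<Sum>i\<in>{..<m} - {u}. ?l i)"
      using assms(2) by (subst sum.remove[of _ u]) auto
    also have "(\<Sum>i\<in>{..<m} - {u}. ?l i) = (\<Sum>i\<in>{..<m} - {u}. l i)" by (intro sum.cong) auto
    also have "?l u + \<dots> = (\<Sum>i<m. l i) + 1"
      using assms(2) by (subst (2) sum.remove[of _ u]) auto
    finally show ?thesis .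
  qed
  ultimately have "m * ((m + 1) * m) - (\<Sum>i<m. l i) = Suc (m * ((m + 1) * m) - (\<Sum>i<m. ?l i))"
    by linarith
  moreover have "card {k. k < n \<and> \<not> optimal \<alpha> ?l k} \<le> card {..<n}" by (intro card_mono) auto
  ultimately show "potential \<alpha> ?l < potential \<alpha> l"
    unfolding potential_def by simp
qed

section \<open>Counting heavily loaded machines, and the repair phase\<close>

definition settled :: "(nat \<Rightarrow> nat) \<Rightarrow> bool" where
  "settled \<alpha> \<longleftrightarrow>
     (\<forall>j<n. \<alpha> j < m \<and> p (\<alpha> j) j \<le> T) \<and>
     (\<forall>i<m. over \<alpha> i \<longrightarrow> (\<exists>j<n. \<alpha> j = i \<and> ld \<alpha> i - p i j \<le> T)) \<and>
     ((\<exists>i<m. over \<alpha> i) \<longrightarrow>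
       card {i. i < m \<and> slack < of_nat H * ld \<alpha> i} + card {i. i < m \<and> over \<alpha> i} \<le> H)"

lemma over_slack_less: "over \<alpha> i \<Longrightarrow> slack < of_nat H * ld \<alpha> i"
proof -
  assume "over \<alpha> i"
  hence "slack < of_nat H * (ld \<alpha> i - T)" by (simp add: overfull_def)
  also have "\<dots> \<le> of_nat H * ld \<alpha> i" using T_pos by (intro mult_left_mono) auto
  finally show ?thesis .
qed

text \<open>The counting bound is Markov's inequality; an overfull machine counts twice because
  \<open>slack \<le> T * H\<close>.\<close>

lemma settled_if_no_bad:
  assumes inv: "inv \<alpha> l" and "\<forall>i<m. \<not> bad \<alpha> i"
  shows "settled \<alpha>"
proof -
  define A where "A = {i. i < m \<and> slack < of_nat H * ld \<alpha> i}"
  define B where "B = {i. i < m \<and> over \<alpha> i}"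
  have fin: "finite A" "finite B" by (auto simp: A_def B_def)
  have sub: "B \<subseteq> A" "A \<subseteq> {..<m}" by (auto simp: A_def B_def over_slack_less)
  have ex: "\<exists>j<n. \<alpha> j = i \<and> ld \<alpha> i - p i j \<le> T" if "i < m" "over \<alpha> i" for i
    using assms(2) that by (auto simp: irreparable_def not_less)
  have count: "card A + card B \<le> H" if "\<exists>i<m. over \<alpha> i"
  proof (cases "slack = L * of_nat m")
    \<comment> \<open>Here \<open>L / h > T\<close> and the Markov estimate is of no use. But a
      removable job has length at most \<open>T\<close>, so a machine that has one carries at most
      \<open>2 * T\<close> and is not overfull. This case is the reason why the count in
      \<open>settled\<close> is conditional.\<close>
    case False
    hence slack: "slack = T * of_nat H" by (auto simp: slack_def min_def split: if_splits)
    from that obtain i where i: "i < m" "over \<alpha> i" by blast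
    with ex obtain j where j: "j < n" "\<alpha> j = i" "ld \<alpha> i - p i j \<le> T" by blast
    hence "p i j \<le> T" using inv by (auto simp: inv_def)
    hence "ld \<alpha> i - T \<le> T" using j by simp
    hence "of_nat H * (ld \<alpha> i - T) \<le> of_nat H * T" by (intro mult_left_mono) auto
    hence False using i slack by (simp add: overfull_def mult.commute)
    thus ?thesis ..
  next
    case True
    have slack_le: "slack \<le> of_nat H * T" by (simp add: slack_def mult.commute)
    have "B \<noteq> {}" using that by (auto simp: B_def)
    have "of_nat (card A + card B) * slack = (\<Sum>i\<in>A. slack) + (\<Sum>i\<in>B. slack)"
      by (simp add: algebra_simps)
    also have "(\<Sum>i\<in>A. slack) = (\<Sum>i\<in>A - B. slack) + (\<Sum>i\<in>B. slack)"
      by (rule sum.subset_diff[OF sub(1) fin(1)])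
    also have "(\<Sum>i\<in>A - B. slack) + (\<Sum>i\<in>B. slack) + (\<Sum>i\<in>B. slack) =
        (\<Sum>i\<in>A - B. slack) + (\<Sum>i\<in>B. slack + slack)" by (simp add: sum.distrib)
    \<comment> \<open>Strictness, which comes from \<open>B\<close> being nonempty, matters: for
      \<open>H = m\<close> a weak inequality would only bound the count by
      \<open>H + 1\<close>.\<close>
    also have "\<dots> < (\<Sum>i\<in>A - B. of_nat H * ld \<alpha> i) + (\<Sum>i\<in>B. of_nat H * ld \<alpha> i)"
    proof (rule add_le_less_mono)
      show "(\<Sum>i\<in>A - B. slack) \<le> (\<Sum>i\<in>A - B. of_nat H * ld \<alpha> i)"
        by (intro sum_mono) (auto simp: A_def order_less_imp_le)
      have "slack + slack < of_nat H * ld \<alpha> i" if "i \<in> B" for i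
      proof -
        have "slack < of_nat H * (ld \<alpha> i - T)" using that by (simp add: B_def overfull_def)
        thus ?thesis using slack_le by (simp add: algebra_simps)
      qed
      thus "(\<Sum>i\<in>B. slack + slack) < (\<Sum>i\<in>B. of_nat H * ld \<alpha> i)"
        using fin \<open>B \<noteq> {}\<close> by (intro sum_strict_mono) auto
    qed
    also have "\<dots> = (\<Sum>i\<in>A. of_nat H * ld \<alpha> i)"
      by (rule sum.subset_diff[OF sub(1) fin(1), symmetric])
    also have "\<dots> \<le> (\<Sum>i<m. of_nat H * ld \<alpha> i)"
      using sub by (intro sum_mono2) (auto simp: ld_nonneg)
    also have "\<dots> = of_nat H * (\<Sum>i<m. ld \<alpha> i)" by (simp add: sum_distrib_left)
    also have "\<dots> \<le> of_nat H * (of_nat (m + 1) * L)"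
      by (intro mult_left_mono total_load_le[OF inv]) auto
    finally have "of_nat ((card A + card B) * m) * L < of_nat (H * (m + 1)) * L"
      unfolding True by (simp add: algebra_simps)
    hence "(card A + card B) * m < H * (m + 1)"
      using mult_less_cancel_right_pos[OF L_pos] of_nat_less_iff by blast
    also have "\<dots> \<le> (H + 1) * m" using H_le by simp
    finally have "card A + card B < H + 1" using mult_less_cancel2 by blast
    thus ?thesis by simp
  qed
  thus ?thesis using ex inv by (auto simp: settled_def A_def B_def inv_def)
qed

text \<open>A pigeonhole argument: the overfull machine \<open>u\<close> uses up one unit of the
  count, so at most \<open>H - 1\<close> machines are heavy, while \<open>j\<close> has at least
  \<open>H\<close> legal ones.\<close>

lemma settled_free_machine:
  assumes "settled \<alpha>" "u < m" "over \<alpha> u" "j < n"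
  shows "\<exists>i<m. p i j \<le> T \<and> of_nat H * ld \<alpha> i \<le> slack"
proof (rule ccontr)
  assume "\<not> ?thesis"
  hence "{i. i < m \<and> p i j \<le> T} \<subseteq> {i. i < m \<and> slack < of_nat H * ld \<alpha> i}" by (auto simp: not_le)
  hence "card {i. i < m \<and> p i j \<le> T} \<le> card {i. i < m \<and> slack < of_nat H * ld \<alpha> i}"
    by (intro card_mono) auto
  moreover have "H \<le> card {i. i < m \<and> p i j \<le> T}" using legal_card assms(4) by blast
  moreover have "0 < card {i. i < m \<and> over \<alpha> i}" using assms(2,3) by (subst card_gt_0_iff) auto
  moreover have "card {i. i < m \<and> slack < of_nat H * ld \<alpha> i} + card {i. i < m \<and> over \<alpha> i} \<le> H"
    using assms by (auto simp: settled_def)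
  ultimately show False by linarith
qed

text \<open>The receiver gains at most \<open>T\<close>, so it may become heavy but not overfull.
  The unit this adds to the first count is paid for by \<open>u\<close>, which leaves the second. No
  third machine changes its load or its jobs.\<close>

lemma settled_move:
  assumes "settled \<alpha>" "u < m" "over \<alpha> u" "j < n" "\<alpha> j = u" "ld \<alpha> u - p u j \<le> T"
    and b: "b < m" "p b j \<le> T" "of_nat H * ld \<alpha> b \<le> slack"
  shows "settled (\<alpha>(j := b))" and "\<And>i. i < m \<Longrightarrow> over (\<alpha>(j := b)) i \<longleftrightarrow> over \<alpha> i \<and> i \<noteq> u"
proof -
  let ?\<beta> = "\<alpha>(j := b)"
  have "b \<noteq> u" using over_slack_less[OF assms(3)] b(3) by auto
  have not_over: "\<not> over \<gamma> i" if "ld \<gamma> i \<le> T" for \<gamma> i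
    using over_load[of \<gamma> i] that by auto
  have u: "ld ?\<beta> u = ld \<alpha> u - p u j" using assms(4,5) \<open>b \<noteq> u\<close> by (simp add: machine_load_move)
  have lb: "ld ?\<beta> b = ld \<alpha> b + p b j" using assms(4,5) \<open>b \<noteq> u\<close> by (simp add: machine_load_move)
  have other: "ld ?\<beta> i = ld \<alpha> i" if "i \<noteq> u" "i \<noteq> b" for i
    using that assms(4,5) by (simp add: machine_load_move)
  have "of_nat H * (ld ?\<beta> b - T) \<le> of_nat H * ld \<alpha> b"
    using lb b(2) by (intro mult_left_mono) auto
  hence "\<not> over ?\<beta> b" using b(3) by (auto simp: overfull_def)
  moreover have "\<not> over \<alpha> b" using over_slack_less b(3) by force
  moreover have "\<not> over ?\<beta> u" using assms(6) u by (intro not_over) simp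
  ultimately show over: "over ?\<beta> i \<longleftrightarrow> over \<alpha> i \<and> i \<noteq> u" for i
    using other[of i] by (cases "i = u"; cases "i = b") (auto simp: overfull_def)
  have legal: "\<forall>k<n. ?\<beta> k < m \<and> p (?\<beta> k) k \<le> T" using assms by (auto simp: settled_def)
  have "\<exists>k<n. ?\<beta> k = i \<and> ld ?\<beta> i - p i k \<le> T" if "i < m" "over ?\<beta> i" for i
  proof -
    have i: "over \<alpha> i" "i \<noteq> u" "i \<noteq> b" using that over \<open>\<not> over ?\<beta> b\<close> by auto
    then obtain k where "k < n" "\<alpha> k = i" "ld \<alpha> i - p i k \<le> T"
      using assms(1) \<open>i < m\<close> unfolding settled_def by blast
    moreover have "k \<noteq> j" using calculation i assms(5) by auto
    ultimately show ?thesis using other i by (intro exI[of _ k]) auto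
  qed
  moreover have "card {i. i < m \<and> slack < of_nat H * ld ?\<beta> i} + card {i. i < m \<and> over ?\<beta> i} \<le> H"
  proof -
    have "card {i. i < m \<and> slack < of_nat H * ld ?\<beta> i} \<le>
        card (insert b {i. i < m \<and> slack < of_nat H * ld \<alpha> i})"
    proof (intro card_mono subsetI)
      fix i
      assume "i \<in> {i. i < m \<and> slack < of_nat H * ld ?\<beta> i}"
      thus "i \<in> insert b {i. i < m \<and> slack < of_nat H * ld \<alpha> i}"
        using other[of i] assms(2) over_slack_less[OF assms(3)] by (cases "i = u"; cases "i = b") auto
    qed auto
    also have "\<dots> \<le> Suc (card {i. i < m \<and> slack < of_nat H * ld \<alpha> i})" by (rule card_insert_le_m1) auto
    finally have "card {i. i < m \<and> slack < of_nat H * ld ?\<beta> i} \<le>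
      Suc (card {i. i < m \<and> slack < of_nat H * ld \<alpha> i})" .
    moreover have "{i. i < m \<and> over \<alpha> i} = insert u {i. i < m \<and> over ?\<beta> i}"
      using assms(2,3) over by auto
    hence "card {i. i < m \<and> over \<alpha> i} = Suc (card {i. i < m \<and> over ?\<beta> i})"
      using over by (simp add: card_insert_if)
    moreover have "card {i. i < m \<and> slack < of_nat H * ld \<alpha> i} + card {i. i < m \<and> over \<alpha> i} \<le> H"
      using assms by (auto simp: settled_def)
    ultimately show ?thesis by linarith
  qed
  ultimately show "settled ?\<beta>" using legal by (auto simp: settled_def simp del: fun_upd_apply)
qed

text \<open>The makespan bound with \<open>h = H / m\<close> and denominators cleared, so that it
  also makes sense over the integers.\<close>

definition solves :: "(nat \<Rightarrow> nat) \<Rightarrow> bool" where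
  "solves \<alpha> \<longleftrightarrow> (\<forall>j<n. \<alpha> j < m) \<and>
     (\<forall>i<m. of_nat H * ld \<alpha> i \<le> of_nat H * T + L * of_nat m \<and> ld \<alpha> i \<le> 2 * T)"

lemma solves_if_settled:
  assumes "settled \<alpha>" "\<forall>i<m. \<not> over \<alpha> i"
  shows "solves \<alpha>"
proof -
  have "of_nat H * ld \<alpha> i \<le> of_nat H * T + L * of_nat m \<and> ld \<alpha> i \<le> 2 * T" if "i < m" for i
  proof -
    have *: "of_nat H * ld \<alpha> i \<le> of_nat H * T + slack"
      using assms(2) that by (auto simp: overfull_def algebra_simps not_less)
    also have "\<dots> \<le> of_nat H * T + of_nat H * T" by (simp add: slack_def mult.commute)
    also have "\<dots> = of_nat H * (2 * T)" by simp
    finally have "ld \<alpha> i \<le> 2 * T" using H_pos by (subst (asm) mult_le_cancel_left_pos) auto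
    moreover have "slack \<le> L * of_nat m" by (simp add: slack_def)
    ultimately show ?thesis using * by auto
  qed
  thus ?thesis using assms(1) by (auto simp: solves_def settled_def)
qed

lemma optimal_machine_exists:
  assumes "j < n"
  shows "\<exists>b<m. p b j \<le> T \<and> (\<forall>i<m. p i j \<le> T \<longrightarrow> price l b j \<le> price l i j)"
proof -
  let ?S = "{i. i < m \<and> p i j \<le> T}"
  have "0 < card ?S" using legal_card H_pos assms by (meson less_le_trans)
  hence "finite ?S" "?S \<noteq> {}" by (auto simp: card_gt_0_iff)
  from ex_min_if_finite[of "(\<lambda>i. price l i j) ` ?S"] this
  obtain b where "b \<in> ?S" "\<And>i. i \<in> ?S \<Longrightarrow> \<not> price l i j < price l b j" by auto
  thus ?thesis by (intro exI[of _ b]) (auto simp: not_less)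
qed

lemma no_bad_exists: "inv \<alpha> l \<Longrightarrow> \<exists>\<beta> l'. inv \<beta> l' \<and> (\<forall>i<m. \<not> bad \<beta> i)"
proof (induction "potential \<alpha> l" arbitrary: \<alpha> l rule: less_induct)
  case less
  show ?case
  proof (cases "\<forall>i<m. \<not> bad \<alpha> i")
    case False
    then obtain u where u: "u < m" "bad \<alpha> u" by blast
    show ?thesis
    proof (cases "\<forall>j<n. \<alpha> j = u \<longrightarrow> optimal \<alpha> l j")
      case True
      show ?thesis
        by (rule less(1)[OF step_raise(2,1)[OF less(2) u True]])
    next
      case False
      then obtain j where j: "j < n" "\<alpha> j = u" "\<not> optimal \<alpha> l j" by blast
      obtain b where b: "b < m" "p b j \<le> T" "\<forall>i<m. p i j \<le> T \<longrightarrow> price l b j \<le> price l i j"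
        using optimal_machine_exists[OF j(1)] by blast
      have "price l b j < price l u j" using j b by (auto simp: optimally_placed_def not_le)
      from step_move[OF less(2) u j(1,2) b(1,2) this b(3)] show ?thesis by (intro less(1))
    qed
  qed (use less in blast)
qed

lemma settled_solution_exists: "settled \<alpha> \<Longrightarrow> \<exists>\<beta>. solves \<beta>"
proof (induction "card {i. i < m \<and> over \<alpha> i}" arbitrary: \<alpha> rule: less_induct)
  case less
  show ?case
  proof (cases "\<forall>i<m. \<not> over \<alpha> i")
    case False
    then obtain u where u: "u < m" "over \<alpha> u" by blast
    then obtain j where j: "j < n" "\<alpha> j = u" "ld \<alpha> u - p u j \<le> T" using less(2) by (auto simp: settled_def)
    obtain b where b: "b < m" "p b j \<le> T" "of_nat H * ld \<alpha> b \<le> slack"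
      using settled_free_machine[OF less(2) u j(1)] by blast
    note move = settled_move[OF less(2) u j b]
    have "{i. i < m \<and> over (\<alpha>(j := b)) i} \<subset> {i. i < m \<and> over \<alpha> i}" using move(2) u by auto
    hence "card {i. i < m \<and> over (\<alpha>(j := b)) i} < card {i. i < m \<and> over \<alpha> i}"
      by (intro psubset_card_mono) auto
    from less(1)[OF this move(1)] show ?thesis .
  qed (use less solves_if_settled in blast)
qed

text \<open>The theorem asserts a good assignment for irrational data too, which no program input
  encodes. For these the auction and the repair are run as mere descent arguments.\<close>

lemma solution_exists: "\<exists>\<alpha>. solves \<alpha>"
proof -
  obtain \<alpha> where "\<forall>j<n. \<alpha> j < m \<and> p (\<alpha> j) j \<le> T \<and>
      (\<forall>i<m. p i j \<le> T \<longrightarrow> price (\<lambda>_. 0) (\<alpha> j) j \<le> price (\<lambda>_. 0) i j)"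
    using optimal_machine_exists[where l = "\<lambda>_. 0"] by metis
  hence "inv \<alpha> (\<lambda>_. 0)" by (intro inv_init) (auto simp: optimally_placed_def)
  thus ?thesis using no_bad_exists settled_if_no_bad settled_solution_exists by blast
qed

end

text \<open>Weak duality: weight the job equations by \<open>c j\<close>, the machine constraints by
  \<open>l i\<close> and the budget constraint by \<open>m + 1\<close>. Illegal pairs drop out
  because \<open>x\<close> vanishes there, so \<open>c\<close> is constrained on legal pairs
  only.\<close>

lemma lp_feasible_dual:
  fixes p :: "nat \<Rightarrow> nat \<Rightarrow> real" and l :: "nat \<Rightarrow> nat"
  assumes "lp_feasible m n p T L" "\<forall>i<m. \<forall>j<n. 0 \<le> p i j"
    and c: "\<forall>i<m. \<forall>j<n. p i j \<le> T \<longrightarrow> c j \<le> real (l i + m + 1) * p i j"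
  shows "(\<Sum>j<n. c j) \<le> T * (\<Sum>i<m. real (l i)) + real (m + 1) * real m * L"
proof -
  obtain x where budget: "(\<Sum>i<m. \<Sum>j<n. p i j * x i j) \<le> real m * L"
    and job: "\<forall>j<n. (\<Sum>i<m. x i j) = 1"
    and machine: "\<forall>i<m. (\<Sum>j<n. p i j * x i j) \<le> T"
    and x: "\<forall>i<m. \<forall>j<n. 0 \<le> x i j" "\<forall>i<m. \<forall>j<n. p i j > T \<longrightarrow> x i j = 0"
    using assms(1) unfolding lp_feasible_def by blast
  have "(\<Sum>j<n. c j) = (\<Sum>j<n. \<Sum>i<m. c j * x i j)"
    using job by (simp flip: sum_distrib_left)
  also have "\<dots> \<le> (\<Sum>j<n. \<Sum>i<m. real (l i + m + 1) * p i j * x i j)"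
  proof (intro sum_mono)
    fix i j
    assume "j \<in> {..<n}" "i \<in> {..<m}"
    thus "c j * x i j \<le> real (l i + m + 1) * p i j * x i j"
      using x c by (cases "p i j \<le> T") (auto intro!: mult_right_mono)
  qed
  also have "\<dots> = (\<Sum>i<m. \<Sum>j<n. real (l i + m + 1) * p i j * x i j)" by (rule sum.swap)
  also have "\<dots> = (\<Sum>i<m. real (l i) * (\<Sum>j<n. p i j * x i j)) +
      real (m + 1) * (\<Sum>i<m. \<Sum>j<n. p i j * x i j)"
    by (simp add: sum_distrib_left algebra_simps sum.distrib)
  also have "\<dots> \<le> (\<Sum>i<m. real (l i) * T) + real (m + 1) * (real m * L)"
    using machine budget by (intro add_mono sum_mono mult_left_mono) auto
  finally show ?thesis by (simp add: sum_distrib_left mult_ac)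
qed

section \<open>The program on integer data\<close>

abbreviation Entry :: "aexp \<Rightarrow> aexp \<Rightarrow> aexp" where
  "Entry i j \<equiv> Load ''P'' (Add (Mul i (Var ''n'')) j)"

abbreviation Price :: "aexp \<Rightarrow> aexp \<Rightarrow> aexp" where
  "Price i j \<equiv> Mul (Add (Load ''w'' i) (Add (Var ''m'') (Const 1))) (Entry i j)"

abbreviation Overfull :: bexp where
  "Overfull \<equiv> Less (Var ''M'') (Mul (Var ''H'') (Sub (Load ''ld'' (Var ''u'')) (Var ''T'')))"

text \<open>Starting the scan at the current machine makes \<open>b\<close> a valid index even if no
  machine is legal, and keeps a job in place when there is a tie.\<close>

definition best_machine :: com where
  "best_machine = Seq (Assign ''b'' (Load ''alpha'' (Var ''j'')))
     (For ''i'' (Var ''m'')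
       (If (Conj (Neg (Less (Var ''T'') (Entry (Var ''i'') (Var ''j''))))
                 (Less (Price (Var ''i'') (Var ''j'')) (Price (Var ''b'') (Var ''j''))))
         (Assign ''b'' (Var ''i'')) Skip))"

definition move :: "vname \<Rightarrow> vname \<Rightarrow> com" where
  "move v c =
     Seq (Store ''ld'' (Load ''alpha'' (Var v))
           (Sub (Load ''ld'' (Load ''alpha'' (Var v))) (Entry (Load ''alpha'' (Var v)) (Var v))))
    (Seq (Store ''ld'' (Var c) (Add (Load ''ld'' (Var c)) (Entry (Var c) (Var v))))
         (Store ''alpha'' (Var v) (Var c)))"

text \<open>Sets \<open>v\<close> to \<open>j + 1\<close> for some job \<open>j\<close> whose removal brings machine \<open>u\<close> down to \<open>T\<close>, and to
  \<open>0\<close> if there is none.\<close>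

definition removable_job :: com where
  "removable_job = Seq (Assign ''v'' (Const 0))
     (For ''j'' (Var ''n'')
       (If (Conj (Equal (Load ''alpha'' (Var ''j'')) (Var ''u''))
                 (Neg (Less (Var ''T'') (Sub (Load ''ld'' (Var ''u'')) (Entry (Var ''u'') (Var ''j''))))))
         (Assign ''v'' (Add (Var ''j'') (Const 1))) Skip))"

definition irreparable_machine :: com where
  "irreparable_machine = Seq (Assign ''x'' (Const 0))
     (For ''u'' (Var ''m'')
       (If Overfull
         (Seq removable_job
           (If (Equal (Var ''v'') (Const 0)) (Assign ''x'' (Add (Var ''u'') (Const 1))) Skip))
         Skip))"

text \<open>The target is copied to \<open>c\<close> because the scan of later jobs overwrites
  \<open>b\<close>.\<close>

definition misplaced_job :: com where
  "misplaced_job = Seq (Assign ''v'' (Const 0))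
     (For ''j'' (Var ''n'')
       (If (Equal (Load ''alpha'' (Var ''j'')) (Var ''u''))
         (Seq best_machine
           (If (Less (Price (Var ''b'') (Var ''j'')) (Price (Var ''u'') (Var ''j'')))
             (Seq (Assign ''v'' (Add (Var ''j'') (Const 1))) (Assign ''c'' (Var ''b''))) Skip))
         Skip))"

definition auction_step :: com where
  "auction_step = Seq irreparable_machine
     (If (Equal (Var ''x'') (Const 0)) Skip
       (Seq (Assign ''u'' (Sub (Var ''x'') (Const 1)))
       (Seq misplaced_job
         (If (Equal (Var ''v'') (Const 0))
           (Store ''w'' (Var ''u'') (Add (Load ''w'' (Var ''u'')) (Const 1)))
           (Seq (Assign ''v'' (Sub (Var ''v'') (Const 1))) (move ''v'' ''c''))))))"

text \<open>The number of rounds is the bound of \<open>potential_init\<close> plus one. Once no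
  machine is irreparable, the remaining rounds are idle.\<close>

definition auction :: com where
  "auction = For ''it''
     (Add (Add (Mul (Mul (Var ''m'') (Mul (Add (Var ''m'') (Const 1)) (Var ''m''))) (Add (Var ''n'') (Const 1)))
       (Var ''n'')) (Const 1))
     auction_step"

text \<open>The default \<open>u\<close> only serves to keep \<open>c\<close> a valid index on
  inputs without a free machine.\<close>

definition free_machine :: com where
  "free_machine = Seq (Assign ''c'' (Var ''u''))
     (For ''i'' (Var ''m'')
       (If (Conj (Neg (Less (Var ''T'') (Entry (Var ''i'') (Var ''v''))))
                 (Neg (Less (Var ''M'') (Mul (Var ''H'') (Load ''ld'' (Var ''i''))))))
         (Assign ''c'' (Var ''i'')) Skip))"

text \<open>One pass is enough, since by \<open>settled_move\<close> a receiving machine never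
  becomes overfull.\<close>

definition repair :: com where
  "repair = For ''u'' (Var ''m'')
     (If Overfull
       (Seq removable_job
         (If (Equal (Var ''v'') (Const 0)) Skip
           (Seq (Assign ''v'' (Sub (Var ''v'') (Const 1)))
           (Seq free_machine (move ''v'' ''c'')))))
       Skip)"

text \<open>Zeroed memory already encodes all jobs on machine 0. The first loop makes the load array
  agree with that, after which the generic \<open>best_machine\<close> and \<open>move\<close>
  apply.\<close>

definition initial_assignment :: com where
  "initial_assignment = Seq
     (For ''j'' (Var ''n'')
       (Store ''ld'' (Const 0) (Add (Load ''ld'' (Const 0)) (Entry (Const 0) (Var ''j'')))))
     (For ''j'' (Var ''n'') (Seq best_machine (move ''j'' ''b'')))"

section \<open>Write sets and specifications of the subprograms\<close>

lemma modified_best_machine [simp]: "modified best_machine = {''b'', ''i''}"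
  by (auto simp: best_machine_def)

lemma modified_move [simp]: "modified (move v c) = {''ld'', ''alpha''}"
  by (auto simp: move_def)

lemma modified_removable_job [simp]: "modified removable_job = {''v'', ''j''}"
  by (auto simp: removable_job_def)

lemma modified_irreparable_machine [simp]:
  "modified irreparable_machine = {''v'', ''j'', ''u'', ''x''}"
  by (auto simp: irreparable_machine_def)

lemma modified_misplaced_job [simp]: "modified misplaced_job = {''v'', ''j'', ''b'', ''i'', ''c''}"
  by (auto simp: misplaced_job_def)

lemma modified_auction_step [simp]: "modified auction_step =
  {''v'', ''j'', ''u'', ''x'', ''b'', ''i'', ''c'', ''w'', ''ld'', ''alpha''}"
  by (auto simp: auction_step_def)

lemma modified_free_machine [simp]: "modified free_machine = {''c'', ''i''}"
  by (auto simp: free_machine_def)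

text \<open>\<open>B_less\<close> leaves room for one more entry on top of a full load, as in the
  middle of a move; \<open>rounds_le\<close> makes the number of auction rounds an admissible loop
  count. Since running time has to be bounded on all inputs, feasibility is not assumed
  here.\<close>

locale int_scheduling =
  fixes m n :: nat and P :: "nat \<Rightarrow> nat \<Rightarrow> int" and T L M :: int and H X :: nat and B :: int
  assumes m_pos: "0 < m" and n_pos: "0 < n"
    and P_nonneg: "\<forall>i<m. \<forall>j<n. 0 \<le> P i j" and P_le: "\<forall>i<m. \<forall>j<n. P i j \<le> B"
    and B_less: "(int n + 1) * B < 2 ^ X"
    and M_eq: "M = min (L * int m) (T * int H)"
    and rounds_le: "m * ((m + 1) * m) * (n + 1) + n + 1 \<le> X"
begin

definition base :: "state \<Rightarrow> bool" where
  "base s \<longleftrightarrow> s ''m'' 0 = int m \<and> s ''n'' 0 = int n \<and> s ''T'' 0 = T \<and> s ''M'' 0 = M \<and> s ''H'' 0 = int H \<and>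
     (\<forall>i<m. \<forall>j<n. s ''P'' (int i * int n + int j) = P i j)"

definition conf :: "(nat \<Rightarrow> nat) \<Rightarrow> (nat \<Rightarrow> nat) \<Rightarrow> state \<Rightarrow> bool" where
  "conf \<alpha> l s \<longleftrightarrow> (\<forall>j<n. s ''alpha'' (int j) = int (\<alpha> j) \<and> \<alpha> j < m) \<and>
     (\<forall>i<m. s ''w'' (int i) = int (l i) \<and> s ''ld'' (int i) = machine_load n P \<alpha> i)"

lemma X_bounds: "m \<le> X" "n \<le> X"
proof -
  have "m * 1 * 1 \<le> m * ((m + 1) * m) * (n + 1)" using m_pos by (intro mult_le_mono) auto
  thus "m \<le> X" "n \<le> X" using rounds_le by linarith+
qed

lemma int_less_power: "k \<le> X \<Longrightarrow> int k < 2 ^ X"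
  by (metis le_less_trans less_exp of_nat_less_numeral_power_cancel_iff)

lemma machine_less_power: "i < m \<Longrightarrow> i < 2 ^ X"
  using X_bounds(1) less_exp[of X] by linarith

lemma B_nonneg: "0 \<le> B"
  using P_nonneg P_le m_pos n_pos by (meson order_trans)

lemma load_nonneg: "i < m \<Longrightarrow> 0 \<le> machine_load n P \<alpha> i"
  using machine_load_nonneg[OF P_nonneg] .

lemma load_le:
  assumes "i < m"
  shows "machine_load n P \<alpha> i \<le> int n * B"
proof -
  have "machine_load n P \<alpha> i \<le> (\<Sum>j<n. B)"
    unfolding machine_load_alt using P_le assms B_nonneg by (intro sum_mono) auto
  thus ?thesis by simp
qed

lemma aval_Entry:
  assumes "base s" "aval i s = int i'" "aval j s = int j'" "i' < m" "j' < n"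
  shows "aval (Entry i j) s = P i' j'"
  using assms by (simp add: base_def)

lemma aval_Price:
  assumes "base s" "conf \<alpha> l s" "aval i s = int i'" "aval j s = int j'" "i' < m" "j' < n"
  shows "aval (Price i j) s = job_price m P l i' j'"
  using assms by (simp add: base_def conf_def job_price_def)

lemma wp_best_machine:
  assumes "base s" "conf \<alpha> l s" "s ''j'' 0 = int j" "j < n"
    and Q: "\<And>s' b. (\<And>z. z \<notin> {''b'', ''i''} \<Longrightarrow> s' z = s z) \<Longrightarrow> s' ''b'' 0 = int b \<Longrightarrow> b < m \<Longrightarrow>
      b = \<alpha> j \<or> P b j \<le> T \<Longrightarrow> job_price m P l b j \<le> job_price m P l (\<alpha> j) j \<Longrightarrow>
      \<forall>i<m. P i j \<le> T \<longrightarrow> job_price m P l b j \<le> job_price m P l i j \<Longrightarrow> Q s'"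
  shows "wp X best_machine Q s"
proof -
  have a: "s ''alpha'' (int j) = int (\<alpha> j)" "\<alpha> j < m" using assms by (auto simp: conf_def)
  show ?thesis unfolding best_machine_def
  proof (intro wp_Seq[OF wp_Store], goal_cases)
    case 1
    show ?case using a assms(3) by (simp add: machine_less_power)
  next
    case 2
    show ?case
    proof (rule wp_For[where N = m and I = "\<lambda>k s'. \<exists>b<m. s' ''b'' 0 = int b \<and> (b = \<alpha> j \<or> P b j \<le> T) \<and>
        job_price m P l b j \<le> job_price m P l (\<alpha> j) j \<and>
        (\<forall>i<k. P i j \<le> T \<longrightarrow> job_price m P l b j \<le> job_price m P l i j)"], goal_cases)
      case (3 s')
      thus ?case using assms(1) by (simp add: base_def)
    next
      case 4
      show ?case using a assms(3) by auto
    next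
      case (5 k s')
      note fr = 5(3)
      have s': "base s'" "conf \<alpha> l s'" "s' ''j'' 0 = int j"
        using assms(1-3) by (simp_all add: base_def conf_def fr)
      obtain b where b: "b < m" "s' ''b'' 0 = int b" "b = \<alpha> j \<or> P b j \<le> T"
        "job_price m P l b j \<le> job_price m P l (\<alpha> j) j"
        "\<forall>i<k. P i j \<le> T \<longrightarrow> job_price m P l b j \<le> job_price m P l i j" using 5(4) by blast
      have E: "aval (Entry (Var ''i'') (Var ''j'')) s' = P k j"
        using 5(1,2) s' assms(4) by (intro aval_Entry) auto
      have I: "aval (Price (Var ''i'') (Var ''j'')) s' = job_price m P l k j"
        using 5(1,2) s' assms(4) by (intro aval_Price) auto
      have J: "aval (Price (Var ''b'') (Var ''j'')) s' = job_price m P l b j"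
        using b s' assms(4) by (intro aval_Price) auto
      have T: "aval (Var ''T'') s' = T" using s'(1) by (simp add: base_def)
      show ?case
      proof (intro wp_If wp_Store wp_Skip, goal_cases)
        case 1
        show ?case using 5(1,2) by (simp add: machine_less_power)
      next
        case 2
        hence "P k j \<le> T" "job_price m P l k j < job_price m P l b j"
          unfolding bval.simps E I J T by auto
        thus ?case using b 5(1,2) by (auto simp: less_Suc_eq intro!: exI[of _ k])
      next
        case 3
        hence "P k j \<le> T \<Longrightarrow> job_price m P l b j \<le> job_price m P l k j"
          unfolding bval.simps E I J T by auto
        thus ?case using b by (auto simp: less_Suc_eq intro!: exI[of _ b])
      qed
    next
      case (6 s')
      then obtain b where b: "b < m" "s' ''b'' 0 = int b" "b = \<alpha> j \<or> P b j \<le> T"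
        "job_price m P l b j \<le> job_price m P l (\<alpha> j) j"
        "\<forall>i<m. P i j \<le> T \<longrightarrow> job_price m P l b j \<le> job_price m P l i j" by blast
      have "s' z = s z" if "z \<notin> {''b'', ''i''}" for z using that 6(1)[of z] by auto
      from Q[OF this b(2,1,3-5)] show ?case by blast
    qed (use X_bounds in auto)
  qed
qed

lemma wp_move:
  assumes "base s" "conf \<alpha> l s" "s v 0 = int j" "j < n" "s c 0 = int b" "b < m"
    and ne: "v \<notin> {''ld'', ''alpha''}" "c \<notin> {''ld'', ''alpha''}"
    and Q: "\<And>s'. (\<And>z. z \<notin> {''ld'', ''alpha''} \<Longrightarrow> s' z = s z) \<Longrightarrow> conf (\<alpha>(j := b)) l s' \<Longrightarrow> Q s'"
  shows "wp X (move v c) Q s"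
proof -
  define a where "a = \<alpha> j"
  have a: "s ''alpha'' (int j) = int a" "a < m" using assms by (auto simp: conf_def a_def)
  have P: "s ''P'' (int i * int n + int j) = P i j" if "i < m" for i
    using that assms(1,4) by (simp add: base_def)
  have n: "s ''n'' 0 = int n" using assms(1) by (simp add: base_def)
  have ld: "s ''ld'' (int i) = machine_load n P \<alpha> i" if "i < m" for i
    using that assms(2) by (simp add: conf_def)
  have bnd: "0 \<le> machine_load n P \<alpha> i" "machine_load n P \<alpha> i \<le> int n * B" "0 \<le> P i j" "P i j \<le> B" if "i < m" for i
    using that load_nonneg load_le P_nonneg P_le assms(4) by auto
  have B: "int n * B + B < 2 ^ X" using B_less by (simp add: algebra_simps)
  have nB: "0 \<le> int n * B" using B_nonneg by simp
  show ?thesis unfolding move_def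
  proof (intro wp_Seq[OF wp_Store] wp_Store, goal_cases)
    case 1
    have "\<bar>machine_load n P \<alpha> a - P a j\<bar> < 2 ^ X" using bnd[OF a(2)] B nB by (simp add: abs_less_iff)
    thus ?case using assms(3) a n ld[OF a(2)] P[OF a(2)] by simp
  next
    case 2
    \<comment> \<open>If the job stays where it is (\<open>a = b\<close>), the second store already
      reads the lowered load and restores it.\<close>
    have "\<bar>machine_load n P \<alpha> b - (if a = b then P b j else 0) + P b j\<bar> < 2 ^ X"
      using bnd[OF assms(6)] B nB by (auto simp: abs_less_iff)
    thus ?case using assms(3,5,6) ne a n ld P by (auto split: if_splits)
  next
    case 3
    show ?case using assms(5,6) ne by (simp add: machine_less_power)
  next
    case 4
    show ?case
    proof (rule Q, goal_cases)
      case (1 z)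
      thus ?case by simp
    next
      case 2
      show ?case unfolding conf_def
      proof (intro conjI allI impI, goal_cases)
        case (1 k)
        thus ?case using assms(2,3,5) ne by (simp add: conf_def)
      next
        case (2 k)
        thus ?case using assms(2,6) by (simp add: conf_def)
      next
        case (3 i)
        thus ?case using assms(2) by (simp add: conf_def)
      next
        case (4 i)
        show ?case using 4 assms(3,4,5,6) ne a n ld P
          by (auto simp: machine_load_move a_def)
      qed
    qed
  qed
qed

lemma wp_removable_job:
  assumes "base s" "conf \<alpha> l s" "s ''u'' 0 = int u" "u < m"
    and Q: "\<And>s'. (\<And>z. z \<notin> {''v'', ''j''} \<Longrightarrow> s' z = s z) \<Longrightarrow>
      s' ''v'' 0 = 0 \<and> (\<forall>j<n. \<alpha> j = u \<longrightarrow> T < machine_load n P \<alpha> u - P u j) \<or>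
      (\<exists>j<n. s' ''v'' 0 = int j + 1 \<and> \<alpha> j = u \<and> machine_load n P \<alpha> u - P u j \<le> T) \<Longrightarrow> Q s'"
  shows "wp X removable_job Q s"
  unfolding removable_job_def
proof (intro wp_Seq[OF wp_Store], goal_cases)
  case 2
  show ?case
  proof (rule wp_For[where N = n and I = "\<lambda>k s'.
      s' ''v'' 0 = 0 \<and> (\<forall>j<k. \<alpha> j = u \<longrightarrow> T < machine_load n P \<alpha> u - P u j) \<or>
      (\<exists>j<n. s' ''v'' 0 = int j + 1 \<and> \<alpha> j = u \<and> machine_load n P \<alpha> u - P u j \<le> T)"], goal_cases)
    case (3 s')
    thus ?case using assms(1) by (simp add: base_def)
  next
    case (5 k s')
    note fr = 5(3)
    have s': "base s'" "conf \<alpha> l s'" "s' ''u'' 0 = int u"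
      using assms(1-3) by (simp_all add: base_def conf_def fr)
    have E: "aval (Entry (Var ''u'') (Var ''j'')) s' = P u k"
      using 5(1,2) s' assms(4) by (intro aval_Entry) auto
    have T: "aval (Var ''T'') s' = T" using s'(1) by (simp add: base_def)
    have L: "aval (Load ''ld'' (Var ''u'')) s' = machine_load n P \<alpha> u"
      using s' assms(4) by (simp add: conf_def)
    have A: "aval (Load ''alpha'' (Var ''j'')) s' = int (\<alpha> k)" using s' 5(1,2) by (simp add: conf_def)
    have U: "aval (Var ''u'') s' = int u" using s' by simp
    show ?case
    proof (intro wp_If wp_Store wp_Skip, goal_cases)
      case 1
      have "int (k + 1) < 2 ^ X" using 5(1) X_bounds by (intro int_less_power) simp
      thus ?case using 5(2) by simp
    next
      case 2
      hence "\<alpha> k = u" "machine_load n P \<alpha> u - P u k \<le> T"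
        unfolding bval.simps A U T aval.simps(4) L E by auto
      thus ?case using 5(1,2) by auto
    next
      case 3
      hence "\<alpha> k = u \<Longrightarrow> T < machine_load n P \<alpha> u - P u k"
        unfolding bval.simps A U T aval.simps(4) L E by auto
      thus ?case using 5(4) by (auto simp: less_Suc_eq)
    qed
  next
    case (6 s')
    have "s' z = s z" if "z \<notin> {''v'', ''j''}" for z using that 6(1)[of z] by auto
    from Q[OF this 6(2)] show ?case by blast
  qed (use X_bounds in auto)
qed simp

lemma bval_Overfull:
  assumes "base s" "conf \<alpha> l s" "s ''u'' 0 = int u" "u < m"
  shows "bval Overfull s \<longleftrightarrow> overfull n P T H M \<alpha> u"
  using assms by (simp add: base_def conf_def overfull_def)

lemma wp_irreparable_machine:
  assumes "base s" "conf \<alpha> l s"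
    and Q: "\<And>s'. (\<And>z. z \<notin> {''v'', ''j'', ''u'', ''x''} \<Longrightarrow> s' z = s z) \<Longrightarrow>
      s' ''x'' 0 = 0 \<and> (\<forall>u<m. \<not> irreparable n P T H M \<alpha> u) \<or>
      (\<exists>u<m. s' ''x'' 0 = int u + 1 \<and> irreparable n P T H M \<alpha> u) \<Longrightarrow> Q s'"
  shows "wp X irreparable_machine Q s"
  unfolding irreparable_machine_def
proof (intro wp_Seq[OF wp_Store], goal_cases)
  case 2
  show ?case
  proof (rule wp_For[where N = m and I = "\<lambda>k s'.
      s' ''x'' 0 = 0 \<and> (\<forall>u<k. \<not> irreparable n P T H M \<alpha> u) \<or>
      (\<exists>u<m. s' ''x'' 0 = int u + 1 \<and> irreparable n P T H M \<alpha> u)"], goal_cases)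
    case (3 s')
    thus ?case using assms(1) by (simp add: base_def)
  next
    case (5 k s')
    note fr = 5(3)
    have s': "base s'" "conf \<alpha> l s'"
      using assms(1-2) by (simp_all add: base_def conf_def fr)
    note over = bval_Overfull[OF s' 5(2,1)]
    show ?case
    proof (intro wp_If wp_Skip wp_Seq, goal_cases)
      case 1
      show ?case
      proof (rule wp_removable_job[OF s' 5(2,1)], intro wp_If wp_Store wp_Skip, goal_cases)
        case (1 s'')
        have "int (k + 1) < 2 ^ X" using 5(1) X_bounds by (intro int_less_power) simp
        thus ?case using 1(1) 5(2) by simp
      next
        case (2 s'')
        hence "irreparable n P T H M \<alpha> k" using over \<open>bval Overfull s'\<close> by (auto simp: irreparable_def)
        thus ?case using 2(1) 5(1,2) by auto
      next
        case (3 s'')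
        hence "\<not> irreparable n P T H M \<alpha> k" by (auto simp: irreparable_def not_less)
        thus ?case using 3(1) 5(4) by (auto simp: less_Suc_eq)
      qed
    next
      case 2
      hence "\<not> irreparable n P T H M \<alpha> k" using over by (auto simp: irreparable_def)
      thus ?case using 5(4) by (auto simp: less_Suc_eq)
    qed
  next
    case (6 s')
    have "s' z = s z" if "z \<notin> {''v'', ''j'', ''u'', ''x''}" for z using that 6(1)[of z] by auto
    from Q[OF this 6(2)] show ?case by blast
  qed (use X_bounds in auto)
qed simp

lemma wp_misplaced_job:
  assumes "base s" "conf \<alpha> l s" "s ''u'' 0 = int u" "u < m"
    and Q: "\<And>s'. (\<And>z. z \<notin> {''v'', ''j'', ''b'', ''i'', ''c''} \<Longrightarrow> s' z = s z) \<Longrightarrow>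
      s' ''v'' 0 = 0 \<and> (\<forall>j<n. \<alpha> j = u \<longrightarrow> optimally_placed m P T \<alpha> l j) \<or>
      (\<exists>j<n. \<exists>b<m. s' ''v'' 0 = int j + 1 \<and> s' ''c'' 0 = int b \<and> \<alpha> j = u \<and> P b j \<le> T \<and>
        job_price m P l b j < job_price m P l u j \<and>
        (\<forall>i<m. P i j \<le> T \<longrightarrow> job_price m P l b j \<le> job_price m P l i j)) \<Longrightarrow> Q s'"
  shows "wp X misplaced_job Q s"
  unfolding misplaced_job_def
proof (intro wp_Seq[OF wp_Store], goal_cases)
  case 2
  show ?case
  proof (rule wp_For[where N = n and I = "\<lambda>k s'.
      s' ''v'' 0 = 0 \<and> (\<forall>j<k. \<alpha> j = u \<longrightarrow> optimally_placed m P T \<alpha> l j) \<or>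
      (\<exists>j<n. \<exists>b<m. s' ''v'' 0 = int j + 1 \<and> s' ''c'' 0 = int b \<and> \<alpha> j = u \<and> P b j \<le> T \<and>
        job_price m P l b j < job_price m P l u j \<and>
        (\<forall>i<m. P i j \<le> T \<longrightarrow> job_price m P l b j \<le> job_price m P l i j))"], goal_cases)
    case (3 s')
    thus ?case using assms(1) by (simp add: base_def)
  next
    case (5 k s')
    note fr = 5(3)
    have s': "base s'" "conf \<alpha> l s'" "s' ''u'' 0 = int u"
      using assms(1-3) by (simp_all add: base_def conf_def fr)
    have A: "s' ''alpha'' (int k) = int (\<alpha> k)" using s' 5(1) by (simp add: conf_def)
    show ?case
    proof (intro wp_If wp_Skip wp_Seq, goal_cases)
      case 1
      hence u: "\<alpha> k = u" using 5(2) s'(3) A by simp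
      show ?case
      proof (rule wp_best_machine[OF s'(1,2) 5(2,1)], goal_cases)
        case (1 s'' b)
        note fr'' = 1(1) and b = 1(2-5) and best = 1(6)
        have s'': "base s''" "conf \<alpha> l s''" "s'' ''u'' 0 = int u" "s'' ''j'' 0 = int k"
          using s' 5(2) by (simp_all add: base_def conf_def fr'')
        have p: "aval (Price (Var ''b'') (Var ''j'')) s'' = job_price m P l b k"
          "aval (Price (Var ''u'') (Var ''j'')) s'' = job_price m P l u k"
          using s'' b 5(1) assms(4) by (auto intro!: aval_Price simp del: aval.simps) auto
        show ?case
        proof (intro wp_If wp_Skip wp_Seq[OF wp_Store] wp_Store, goal_cases)
          case 1
          have "int (k + 1) < 2 ^ X" using 5(1) X_bounds by (intro int_less_power) simp
          thus ?case using s''(4) by simp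
        next
          case 2
          show ?case using b by (simp add: machine_less_power)
        next
          case 3
          hence less: "job_price m P l b k < job_price m P l u k" unfolding bval.simps p .
          \<comment> \<open>This excludes the default outcome of \<open>best_machine\<close>, so
            \<open>b\<close> is legal.\<close>
          hence "b \<noteq> u" by auto
          thus ?case using b u s''(4) less best 5(1) by auto
        next
          case 4
          hence "job_price m P l u k \<le> job_price m P l b k" unfolding bval.simps p by simp
          hence "optimally_placed m P T \<alpha> l k" using best u by (force simp: optimally_placed_def)
          thus ?case using 5(4) by (auto simp: less_Suc_eq fr'')
        qed
      qed
    next
      case 2
      hence "\<alpha> k \<noteq> u" using 5(2) s'(3) A by simp
      thus ?case using 5(4) by (auto simp: less_Suc_eq)
    qed
  next
    case (6 s')
    have "s' z = s z" if "z \<notin> {''v'', ''j'', ''b'', ''i'', ''c''}" for z using that 6(1)[of z] by auto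
    from Q[OF this 6(2)] show ?case by blast
  qed (use X_bounds in auto)
qed simp

abbreviation feasible :: bool where
  "feasible \<equiv> feasible_scheduling m n P T L H"

lemma slack_eq: "feasible \<Longrightarrow> feasible_scheduling.slack m T L H = M"
  by (simp add: feasible_scheduling.slack_def M_eq)

text \<open>The interface between program and auction: one round that is idle, raises a price or
  moves a job. Which irreparable machine and which misplaced job are picked is left open.\<close>

definition step_rel :: "(nat \<Rightarrow> nat) \<Rightarrow> (nat \<Rightarrow> nat) \<Rightarrow> (nat \<Rightarrow> nat) \<Rightarrow> (nat \<Rightarrow> nat) \<Rightarrow> bool" where
  "step_rel \<alpha> l \<alpha>' l' \<longleftrightarrow>
     (\<forall>u<m. \<not> irreparable n P T H M \<alpha> u) \<and> \<alpha>' = \<alpha> \<and> l' = l \<or>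
     (\<exists>u<m. irreparable n P T H M \<alpha> u \<and>
       ((\<forall>j<n. \<alpha> j = u \<longrightarrow> optimally_placed m P T \<alpha> l j) \<and> \<alpha>' = \<alpha> \<and> l' = l(u := l u + 1) \<or>
        (\<exists>j<n. \<exists>b<m. \<alpha> j = u \<and> P b j \<le> T \<and> job_price m P l b j < job_price m P l u j \<and>
          (\<forall>i<m. P i j \<le> T \<longrightarrow> job_price m P l b j \<le> job_price m P l i j) \<and> \<alpha>' = \<alpha>(j := b) \<and> l' = l)))"

lemma wp_auction_step:
  assumes "base s" "conf \<alpha> l s" "\<forall>i<m. l i < X"
    and Q: "\<And>s' \<alpha>' l'. conf \<alpha>' l' s' \<Longrightarrow> step_rel \<alpha> l \<alpha>' l' \<Longrightarrow> Q s'"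
  shows "wp X auction_step Q s"
  unfolding auction_step_def
proof (rule wp_Seq, rule wp_irreparable_machine[OF assms(1,2)], rule wp_If, goal_cases)
  case (1 s')
  have "conf \<alpha> l s'" using assms(2) by (simp add: conf_def 1(1))
  moreover have "step_rel \<alpha> l \<alpha> l" using 1(2,3) by (auto simp: step_rel_def)
  ultimately show ?case by (intro wp_Skip Q)
next
  case (2 s')
  then obtain u where u: "u < m" "s' ''x'' 0 = int u + 1" "irreparable n P T H M \<alpha> u" by auto
  have s': "base s'" "conf \<alpha> l s'" using assms(1,2) by (simp_all add: base_def conf_def 2(1))
  show ?case
  proof (intro wp_Seq[OF wp_Store], goal_cases)
    case 1
    show ?case using u by (simp add: machine_less_power)
  next
    case 2
    let ?s = "s'(''u'' := (s' ''u'')(aval (Const 0) s' := aval (Sub (Var ''x'') (Const 1)) s'))"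
    have s1: "base ?s" "conf \<alpha> l ?s" "?s ''u'' 0 = int u" using s' u by (simp_all add: base_def conf_def)
    show ?case
    proof (rule wp_Seq, rule wp_misplaced_job[OF s1 u(1)], rule wp_If, goal_cases)
      case (1 s2)
      have s2: "conf \<alpha> l s2" "s2 ''u'' 0 = int u" using s1 by (simp_all add: conf_def 1(1))
      have opt: "\<forall>j<n. \<alpha> j = u \<longrightarrow> optimally_placed m P T \<alpha> l j" using 1(2,3) by auto
      show ?case
      proof (rule wp_Store, goal_cases)
        case 1
        have "int (l u + 1) < 2 ^ X" using assms(3) u(1) by (intro int_less_power) (simp add: Suc_leI)
        thus ?case using s2 u(1) by (simp add: conf_def)
      next
        case 2
        show ?case
        proof (rule Q)
          show "conf \<alpha> (l(u := l u + 1)) (s2(''w'' := (s2 ''w'')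
              (aval (Var ''u'') s2 := aval (Add (Load ''w'' (Var ''u'')) (Const 1)) s2)))"
            using s2 u(1) by (auto simp: conf_def)
          show "step_rel \<alpha> l \<alpha> (l(u := l u + 1))" using u opt unfolding step_rel_def by blast
        qed
      qed
    next
      case (2 s2)
      then obtain j b where jb: "j < n" "b < m" "s2 ''v'' 0 = int j + 1" "s2 ''c'' 0 = int b" "\<alpha> j = u"
        "P b j \<le> T" "job_price m P l b j < job_price m P l u j"
        "\<forall>i<m. P i j \<le> T \<longrightarrow> job_price m P l b j \<le> job_price m P l i j" by auto
      have s2: "base s2" "conf \<alpha> l s2" using s1 by (simp_all add: base_def conf_def 2(1))
      show ?case
      proof (intro wp_Seq[OF wp_Store], goal_cases)
        case 1
        have "int j < 2 ^ X" using jb(1) X_bounds by (intro int_less_power) simp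
        thus ?case using jb(3) by simp
      next
        case 2
        show ?case
        proof (rule wp_move[of _ \<alpha> l _ j _ b], goal_cases)
          case (9 s3)
          have "step_rel \<alpha> l (\<alpha>(j := b)) l" using u jb unfolding step_rel_def by blast
          with 9 show ?case by (intro Q)
        qed (use s2 jb in \<open>simp_all add: base_def conf_def\<close>)
      qed
    qed
  qed
qed

lemma step_rel_price_le: "step_rel \<alpha> l \<alpha>' l' \<Longrightarrow> l' i \<le> l i + 1"
  by (auto simp: step_rel_def)

lemma step_rel_progress:
  assumes feasible "feasible_scheduling.inv m n P T \<alpha> l" "step_rel \<alpha> l \<alpha>' l'"
  shows "feasible_scheduling.inv m n P T \<alpha>' l'"
    and "(\<forall>u<m. \<not> irreparable n P T H M \<alpha>' u) \<or>
      feasible_scheduling.potential m n P T \<alpha>' l' < feasible_scheduling.potential m n P T \<alpha> l"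
proof -
  interpret feasible_scheduling m n P T L H by fact
  note eq = slack_eq[OF assms(1)]
  consider (idle) "\<forall>u<m. \<not> irreparable n P T H M \<alpha> u" "\<alpha>' = \<alpha>" "l' = l"
    | (raise) u where "u < m" "bad \<alpha> u" "\<forall>j<n. \<alpha> j = u \<longrightarrow> optimal \<alpha> l j" "\<alpha>' = \<alpha>" "l' = l(u := l u + 1)"
    | (move) u j b where "u < m" "bad \<alpha> u" "j < n" "\<alpha> j = u" "b < m" "P b j \<le> T"
        "price l b j < price l u j" "\<forall>i<m. P i j \<le> T \<longrightarrow> price l b j \<le> price l i j"
        "\<alpha>' = \<alpha>(j := b)" "l' = l"
    using assms(3) unfolding step_rel_def eq by blast
  hence "inv \<alpha>' l' \<and> ((\<forall>u<m. \<not> irreparable n P T H M \<alpha>' u) \<or> potential \<alpha>' l' < potential \<alpha> l)"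
  proof cases
    case idle
    thus ?thesis using assms(2) by simp
  next
    case raise
    thus ?thesis using step_raise[OF assms(2) raise(1-3)] by simp
  next
    case move
    thus ?thesis using step_move[OF assms(2) move(1-8)] by simp
  qed
  thus "inv \<alpha>' l'" "(\<forall>u<m. \<not> irreparable n P T H M \<alpha>' u) \<or> potential \<alpha>' l' < potential \<alpha> l" by auto
qed

text \<open>Since a round raises at most one price by one, prices are at most the round number
  \<open>k\<close>, which bounds the stored values on infeasible inputs as well. Under
  \<open>feasible\<close>, \<open>potential + k < N\<close> holds as long as an irreparable machine
  is left; at \<open>k = N\<close> it is absurd.\<close>

lemma wp_auction:
  assumes "base s" "conf \<alpha> (\<lambda>_. 0) s" "feasible \<Longrightarrow> feasible_scheduling.inv m n P T \<alpha> (\<lambda>_. 0)"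
    and Q: "\<And>s' \<alpha>' l'. (\<And>z. z \<notin> insert ''it'' (modified auction_step) \<Longrightarrow> s' z = s z) \<Longrightarrow> conf \<alpha>' l' s' \<Longrightarrow>
      (feasible \<Longrightarrow> feasible_scheduling.settled m n P T L H \<alpha>') \<Longrightarrow> Q s'"
  shows "wp X auction Q s"
  unfolding auction_def
proof -
  define N where "N = m * ((m + 1) * m) * (n + 1) + n + 1"
  show "wp X (For ''it'' (Add (Add (Mul (Mul (Var ''m'') (Mul (Add (Var ''m'') (Const 1)) (Var ''m'')))
      (Add (Var ''n'') (Const 1))) (Var ''n'')) (Const 1)) auction_step) Q s"
  proof (rule wp_For[where N = N and I = "\<lambda>k s'. \<exists>\<alpha> l. conf \<alpha> l s' \<and> (\<forall>i<m. l i \<le> k) \<and>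
      (feasible \<longrightarrow> feasible_scheduling.inv m n P T \<alpha> l \<and>
        ((\<forall>u<m. \<not> irreparable n P T H M \<alpha> u) \<or> feasible_scheduling.potential m n P T \<alpha> l + k < N))"], goal_cases)
    case 2
    show ?case using rounds_le by (simp only: N_def)
  next
    case (3 s')
    thus ?case using assms(1) by (simp add: base_def N_def algebra_simps)
  next
    case (4 f)
    have "conf \<alpha> (\<lambda>_. 0) (s(''it'' := f))" using assms(2) by (simp add: conf_def)
    moreover have "feasible_scheduling.potential m n P T \<alpha> (\<lambda>_. 0) < N" if feasible
      using feasible_scheduling.potential_init[OF that, of \<alpha>] by (simp add: N_def)
    ultimately show ?case using assms(3) by (intro exI[of _ \<alpha>] exI[of _ "\<lambda>_. 0"]) auto
  next
    case (5 k s')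
    then obtain \<alpha> l where s': "conf \<alpha> l s'" "\<forall>i<m. l i \<le> k" and
      inv: "feasible \<Longrightarrow> feasible_scheduling.inv m n P T \<alpha> l" and
      pot: "feasible \<Longrightarrow> (\<forall>u<m. \<not> irreparable n P T H M \<alpha> u) \<or>
        feasible_scheduling.potential m n P T \<alpha> l + k < N" by blast
    have "base s'" using assms(1) by (simp add: base_def 5(3))
    moreover have "k < X" using 5(1) rounds_le by (simp add: N_def)
    hence "\<forall>i<m. l i < X" using s'(2) by auto
    ultimately show ?case
    proof (rule wp_auction_step[OF _ s'(1)], goal_cases)
      case (1 s'' \<alpha>' l')
      have "\<forall>i<m. l' i \<le> Suc k" using step_rel_price_le[OF 1(2)] s'(2)
        by (metis Suc_eq_plus1 Suc_le_mono order_trans)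
      moreover have "conf \<alpha>' l' (s''(''it'' := f))" for f using 1(1) by (simp add: conf_def)
      moreover have "feasible_scheduling.inv m n P T \<alpha>' l'" if feasible
        using step_rel_progress(1)[OF that inv[OF that] 1(2)] .
      moreover have "(\<forall>u<m. \<not> irreparable n P T H M \<alpha>' u) \<or>
        feasible_scheduling.potential m n P T \<alpha>' l' + Suc k < N" if feasible
      proof (cases "\<forall>u<m. \<not> irreparable n P T H M \<alpha> u")
        case True
        hence "\<alpha>' = \<alpha>" using 1(2) by (auto simp: step_rel_def)
        thus ?thesis using True by simp
      next
        case False
        thus ?thesis using step_rel_progress(2)[OF that inv[OF that] 1(2)] pot[OF that] by auto
      qed
      ultimately show ?case by blast
    qed
  next
    case (6 s')
    then obtain \<alpha>' l' where s': "conf \<alpha>' l' s'" and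
      "feasible \<Longrightarrow> feasible_scheduling.inv m n P T \<alpha>' l' \<and> (\<forall>u<m. \<not> irreparable n P T H M \<alpha>' u)" by auto
    hence "feasible \<Longrightarrow> feasible_scheduling.settled m n P T L H \<alpha>'"
      using feasible_scheduling.settled_if_no_bad slack_eq by metis
    with 6(1) s' show ?case by (intro Q)
  qed simp
qed

lemma wp_free_machine:
  assumes "base s" "conf \<alpha> l s" "s ''u'' 0 = int u" "u < m" "s ''v'' 0 = int j" "j < n"
    and Q: "\<And>s' c. (\<And>z. z \<notin> {''c'', ''i''} \<Longrightarrow> s' z = s z) \<Longrightarrow> s' ''c'' 0 = int c \<Longrightarrow> c < m \<Longrightarrow>
      P c j \<le> T \<and> int H * machine_load n P \<alpha> c \<le> M \<or>
      \<not> (\<exists>i<m. P i j \<le> T \<and> int H * machine_load n P \<alpha> i \<le> M) \<Longrightarrow> Q s'"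
  shows "wp X free_machine Q s"
  unfolding free_machine_def
proof (intro wp_Seq[OF wp_Store], goal_cases)
  case 1
  show ?case using assms(3,4) by (simp add: machine_less_power)
next
  case 2
  show ?case
  proof (rule wp_For[where N = m and I = "\<lambda>k s'. \<exists>c<m. s' ''c'' 0 = int c \<and>
      (P c j \<le> T \<and> int H * machine_load n P \<alpha> c \<le> M \<or>
      \<not> (\<exists>i<k. P i j \<le> T \<and> int H * machine_load n P \<alpha> i \<le> M))"], goal_cases)
    case (3 s')
    thus ?case using assms(1) by (simp add: base_def)
  next
    case 4
    show ?case using assms(3,4) by simp
  next
    case (5 k s')
    note fr = 5(3)
    have s': "base s'" "conf \<alpha> l s'" "s' ''v'' 0 = int j"
      using assms(1,2,5) by (simp_all add: base_def conf_def fr)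
    have E: "aval (Entry (Var ''i'') (Var ''v'')) s' = P k j"
      using 5(1,2) s' assms(6) by (intro aval_Entry) auto
    have T: "aval (Var ''T'') s' = T" "aval (Var ''M'') s' = M" "aval (Var ''H'') s' = int H"
      using s'(1) by (simp_all add: base_def)
    have L: "aval (Load ''ld'' (Var ''i'')) s' = machine_load n P \<alpha> k"
      using s' 5(1,2) by (simp add: conf_def)
    show ?case
    proof (intro wp_If wp_Store wp_Skip, goal_cases)
      case 1
      show ?case using 5(1,2) by (simp add: machine_less_power)
    next
      case 2
      hence "P k j \<le> T" "int H * machine_load n P \<alpha> k \<le> M"
        unfolding bval.simps aval.simps(5) T L E by auto
      thus ?case using 5(1,2) by auto
    next
      case 3
      hence "\<not> (P k j \<le> T \<and> int H * machine_load n P \<alpha> k \<le> M)"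
        unfolding bval.simps aval.simps(5) T L E by auto
      thus ?case using 5(4) by (auto simp: less_Suc_eq)
    qed
  next
    case (6 s')
    have fr: "s' z = s z" if "z \<notin> {''c'', ''i''}" for z using that 6(1)[of z] by auto
    from 6(2) show ?case using Q[OF fr] by blast
  qed (use X_bounds in auto)
qed

lemma wp_repair:
  assumes "base s" "conf \<alpha> l s" "feasible \<Longrightarrow> feasible_scheduling.settled m n P T L H \<alpha>"
    and Q: "\<And>s' \<alpha>'. conf \<alpha>' l s' \<Longrightarrow> (feasible \<Longrightarrow> feasible_scheduling.solves m n P T L H \<alpha>') \<Longrightarrow> Q s'"
  shows "wp X repair Q s"
  unfolding repair_def
proof (rule wp_For[where N = m and I = "\<lambda>k s'. \<exists>\<alpha>. conf \<alpha> l s' \<and>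
    (feasible \<longrightarrow> feasible_scheduling.settled m n P T L H \<alpha> \<and> (\<forall>i<k. \<not> overfull n P T H M \<alpha> i))"], goal_cases)
  case (3 s')
  thus ?case using assms(1) by (simp add: base_def)
next
  case (4 f)
  have "conf \<alpha> l (s(''u'' := f))" using assms(2) by (simp add: conf_def)
  thus ?case using assms(3) by auto
next
  case (5 k s')
  then obtain \<alpha> where conf: "conf \<alpha> l s'" and
    settled: "feasible \<Longrightarrow> feasible_scheduling.settled m n P T L H \<alpha>" and
    less: "feasible \<Longrightarrow> \<forall>i<k. \<not> overfull n P T H M \<alpha> i" by blast
  have base: "base s'" using assms(1) by (simp add: base_def 5(3))
  note over = bval_Overfull[OF base conf 5(2,1)]
  have carry: "\<forall>f. \<exists>\<alpha>. conf \<alpha> l (s''(''u'' := f)) \<and>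
      (feasible \<longrightarrow> feasible_scheduling.settled m n P T L H \<alpha> \<and> (\<forall>i<Suc k. \<not> overfull n P T H M \<alpha> i))"
    if "conf \<beta> l s''" "feasible \<Longrightarrow> feasible_scheduling.settled m n P T L H \<beta> \<and> (\<forall>i<Suc k. \<not> overfull n P T H M \<beta> i)"
    for s'' \<beta>
    using that by (intro allI exI[of _ \<beta>]) (auto simp: conf_def)
  show ?case
  proof (intro wp_If wp_Skip wp_Seq, goal_cases)
    case 1
    note over1 = 1[unfolded over]
    show ?case
    proof (rule wp_removable_job[OF base conf 5(2,1)], intro wp_If wp_Skip, goal_cases)
      case (1 s'')
      \<comment> \<open>\<open>settled\<close> supplies every overfull machine with a removable job,
        so only an infeasible input can lead to this branch.\<close>
      have "\<not> feasible"
      proof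
        assume f: feasible
        show False using feasible_scheduling.settled_def[OF f, of \<alpha>] settled[OF f] over1 1(2,3) 5(1)
          unfolding slack_eq[OF f] by fastforce
      qed
      moreover have "conf \<alpha> l s''" using conf by (simp add: conf_def 1(1))
      ultimately show ?case by (intro carry) auto
    next
      case (2 s'')
      note fr = 2(1)
      from 2 obtain j where j: "j < n" "s'' ''v'' 0 = int j + 1" "\<alpha> j = k" "machine_load n P \<alpha> k - P k j \<le> T" by auto
      show ?case
      proof (intro wp_Seq[OF wp_Store], goal_cases)
        case 1
        have "int j < 2 ^ X" using j(1) X_bounds by (intro int_less_power) simp
        thus ?case using j(2) by simp
      next
        case 2
        let ?s = "s''(''v'' := (s'' ''v'')(aval (Const 0) s'' := aval (Sub (Var ''v'') (Const 1)) s''))"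
        have s: "base ?s" "conf \<alpha> l ?s" "?s ''u'' 0 = int k"
          using base conf 5(2) by (simp_all add: base_def conf_def fr)
        have v: "?s ''v'' 0 = int j" using j(2) by simp
        show ?case
        proof (rule wp_Seq, rule wp_free_machine[OF s 5(1) v j(1)], goal_cases)
          case (1 s3 c)
          show ?case
          proof (rule wp_move[of _ \<alpha> l _ j _ c], goal_cases)
            case (9 s4)
            show ?case
            proof (rule carry[OF 9(2)])
              assume f: feasible
              interpret feasible_scheduling m n P T L H by (rule f)
              note eq = slack_eq[OF f]
              have "P c j \<le> T" "int H * machine_load n P \<alpha> c \<le> slack"
                using settled_free_machine[OF settled[OF f] 5(1) _ j(1)] over1 1(4) unfolding eq by auto
              note mv = settled_move[OF settled[OF f] 5(1) _ j(1,3,4) 1(3) this, unfolded eq, OF over1]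
              show "settled (\<alpha>(j := c)) \<and> (\<forall>i<Suc k. \<not> overfull n P T H M (\<alpha>(j := c)) i)"
                using mv less[OF f] 5(1) by (auto simp: less_Suc_eq)
            qed
          qed (use s v j 1 in \<open>simp_all add: base_def conf_def\<close>)
        qed
      qed
    qed
  next
    case 2
    show ?case
      using 2 over conf settled less by (intro carry) (auto simp: less_Suc_eq)
  qed
next
  case (6 s')
  then obtain \<alpha>' where "conf \<alpha>' l s'"
    "feasible \<Longrightarrow> feasible_scheduling.settled m n P T L H \<alpha>' \<and> (\<forall>i<m. \<not> overfull n P T H M \<alpha>' i)" by blast
  thus ?case using Q feasible_scheduling.solves_if_settled slack_eq by metis
qed (use X_bounds in auto)

lemma machine_load_zero: "machine_load n P (\<lambda>_. 0) i = (if i = 0 then \<Sum>j<n. P 0 j else 0)"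
  by (simp add: machine_load_alt)

lemma wp_initial_assignment:
  assumes "base s" "s ''alpha'' = (\<lambda>_. 0)" "s ''w'' = (\<lambda>_. 0)" "s ''ld'' = (\<lambda>_. 0)"
    and Q: "\<And>s' \<alpha>. (\<And>z. z \<notin> {''alpha'', ''ld'', ''j'', ''b'', ''i''} \<Longrightarrow> s' z = s z) \<Longrightarrow>
      conf \<alpha> (\<lambda>_. 0) s' \<Longrightarrow> (feasible \<Longrightarrow> feasible_scheduling.inv m n P T \<alpha> (\<lambda>_. 0)) \<Longrightarrow> Q s'"
  shows "wp X initial_assignment Q s"
  unfolding initial_assignment_def
proof (rule wp_Seq, rule wp_For[where N = n and I = "\<lambda>k s'. \<forall>i. s' ''ld'' i = (if i = 0 then \<Sum>j<k. P 0 j else 0)"], goal_cases)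
  case (3 s')
  thus ?case using assms(1) by (simp add: base_def)
next
  case (5 k s')
  have "base s'" using assms(1) by (simp add: base_def 5(3))
  hence E: "aval (Entry (Const 0) (Var ''j'')) s' = P 0 k"
    using 5(1,2) m_pos by (intro aval_Entry) auto
  have "0 \<le> (\<Sum>j<Suc k. P 0 j)" using P_nonneg m_pos 5(1) by (intro sum_nonneg) auto
  moreover have "(\<Sum>j<Suc k. P 0 j) \<le> (\<Sum>j<n. P 0 j)"
    using P_nonneg m_pos 5(1) by (intro sum_mono2) auto
  moreover have "(\<Sum>j<n. P 0 j) \<le> (\<Sum>j<n. B)" using P_le m_pos by (intro sum_mono) auto
  ultimately have bd: "\<bar>\<Sum>j<Suc k. P 0 j\<bar> < 2 ^ X" using B_less B_nonneg by (simp add: algebra_simps)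
  have val: "aval (Add (Load ''ld'' (Const 0)) (Entry (Const 0) (Var ''j''))) s' = (\<Sum>j<Suc k. P 0 j)"
    unfolding aval.simps(3) E using 5(4) by simp
  show ?case
    by (rule wp_Store) (use bd val 5(4) in \<open>auto simp del: sum.lessThan_Suc\<close>)
next
  case (6 s1)
  have base: "base s1" using assms(1) by (simp add: base_def 6(1))
  have conf: "conf (\<lambda>_. 0) (\<lambda>_. 0) s1"
    using 6(2) assms(2,3) m_pos by (simp add: conf_def machine_load_zero 6(1))
  show ?case
  proof (rule wp_For[where N = n and I = "\<lambda>k s'. \<exists>\<alpha>. conf \<alpha> (\<lambda>_. 0) s' \<and> (\<forall>j<k.
      optimally_placed m P T \<alpha> (\<lambda>_. 0) j \<and> ((\<exists>i<m. P i j \<le> T) \<longrightarrow> P (\<alpha> j) j \<le> T))"], goal_cases)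
    case (3 s')
    thus ?case using base by (simp add: base_def)
  next
    case (4 f)
    have "conf (\<lambda>_. 0) (\<lambda>_. 0) (s1(''j'' := f))" using conf by (simp add: conf_def)
    thus ?case by auto
  next
    case (5 k s')
    then obtain \<alpha> where conf': "conf \<alpha> (\<lambda>_. 0) s'" and \<alpha>: "\<forall>j<k.
      optimally_placed m P T \<alpha> (\<lambda>_. 0) j \<and> ((\<exists>i<m. P i j \<le> T) \<longrightarrow> P (\<alpha> j) j \<le> T)" by blast
    have base': "base s'" using base by (simp add: base_def 5(3))
    show ?case
    proof (rule wp_Seq, rule wp_best_machine[OF base' conf' 5(2,1)], goal_cases)
      case (1 s'' b)
      show ?case
      proof (rule wp_move[of _ \<alpha> "\<lambda>_. 0" _ k _ b], goal_cases)
        case (9 s3)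
        have "conf (\<alpha>(k := b)) (\<lambda>_. 0) (s3(''j'' := f))" for f using 9(2) by (simp add: conf_def)
        \<comment> \<open>With all \<open>l i = 0\<close> the price is proportional to the length,
          so the default machine is kept only if it is no longer than any legal choice, and is then
          legal itself.\<close>
        moreover have "P b k \<le> T" if "i < m" "P i k \<le> T" for i
        proof -
          have "(int m + 1) * P b k \<le> (int m + 1) * P i k"
            using 1(6) that by (simp add: job_price_def algebra_simps)
          hence "P b k \<le> P i k" by (simp add: mult_le_cancel_left)
          thus ?thesis using that by simp
        qed
        ultimately show ?case using \<alpha> 1(6)
          by (intro allI exI[of _ "\<alpha>(k := b)"]) (auto simp: less_Suc_eq optimally_placed_def)
      qed (use base' conf' 1 5 in \<open>simp_all add: base_def conf_def\<close>)
    qed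
  next
    case (6 s')
    then obtain \<alpha> where conf': "conf \<alpha> (\<lambda>_. 0) s'" and \<alpha>: "\<forall>j<n.
      optimally_placed m P T \<alpha> (\<lambda>_. 0) j \<and> ((\<exists>i<m. P i j \<le> T) \<longrightarrow> P (\<alpha> j) j \<le> T)" by blast
    have "feasible_scheduling.inv m n P T \<alpha> (\<lambda>_. 0)" if f: feasible
    proof -
      interpret feasible_scheduling m n P T L H by (rule f)
      show ?thesis
      proof (rule inv_init)
        show "\<forall>j<n. \<alpha> j < m \<and> P (\<alpha> j) j \<le> T"
          using \<alpha> optimal_machine_exists conf' by (fastforce simp: conf_def)
      qed (use \<alpha> in blast)
    qed
    moreover have "s' z = s z" if "z \<notin> {''alpha'', ''ld'', ''j'', ''b'', ''i''}" for z
      using that \<open>\<And>z. z \<notin> insert ''j'' (modified (Seq best_machine (move ''j'' ''b''))) \<Longrightarrow> s' z = s1 z\<close>[of z]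
        \<open>\<And>z. z \<notin> insert ''j'' (modified _) \<Longrightarrow> s1 z = s z\<close>[of z] by auto
    ultimately show ?case using Q conf' by blast
  qed (use X_bounds in auto)
qed (use X_bounds assms(4) in auto)

end

section \<open>Scaling of rational data\<close>

lemma sum_row_major:
  fixes f :: "nat \<Rightarrow> nat \<Rightarrow> 'a::comm_monoid_add"
  shows "(\<Sum>k<m * n. f (k div n) (k mod n)) = (\<Sum>i<m. \<Sum>j<n. f i j)"
proof (cases "n = 0")
  case False
  have split: "(\<Sum>k<a + b. g k) = (\<Sum>k<a. g k) + (\<Sum>k<b. g (a + k))" for g :: "nat \<Rightarrow> 'a" and a b
    by (induction b) (simp_all add: add.assoc)
  show ?thesis
  proof (induction m)
    case (Suc m)
    have "(\<Sum>k<Suc m * n. f (k div n) (k mod n)) = (\<Sum>k<m * n + n. f (k div n) (k mod n))"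
      by (simp add: add.commute)
    also have "\<dots> = (\<Sum>k<m * n. f (k div n) (k mod n)) + (\<Sum>j<n. f ((m * n + j) div n) ((m * n + j) mod n))"
      by (rule split)
    also have "(\<Sum>j<n. f ((m * n + j) div n) ((m * n + j) mod n)) = (\<Sum>j<n. f m j)"
      by (intro sum.cong) auto
    finally show ?case using Suc by simp
  qed simp
qed simp

definition scale :: com where
  "scale =
     Seq (Assign ''D'' (Mul (Var ''T_den'') (Var ''L_den'')))
    (Seq (For ''k'' (Mul (Var ''m'') (Var ''n'')) (Assign ''D'' (Mul (Var ''D'') (Load ''p_den'' (Var ''k'')))))
    (Seq (For ''k'' (Mul (Var ''m'') (Var ''n''))
           (Store ''P'' (Var ''k'') (Mul (Load ''p_num'' (Var ''k'')) (Div (Var ''D'') (Load ''p_den'' (Var ''k''))))))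
    (Seq (Assign ''T'' (Mul (Var ''T_num'') (Div (Var ''D'') (Var ''T_den''))))
         (Assign ''L'' (Mul (Var ''L_num'') (Div (Var ''D'') (Var ''L_den'')))))))"

definition count_legal :: com where
  "count_legal = Seq (Assign ''c'' (Const 0))
     (For ''i'' (Var ''m'')
       (If (Less (Var ''T'') (Entry (Var ''i'') (Var ''j''))) Skip
         (Assign ''c'' (Add (Var ''c'') (Const 1)))))"

text \<open>The initial value \<open>m\<close> bounds every count from above; it makes the running
  minimum range over a nonempty set without affecting the result.\<close>

definition min_legal :: com where
  "min_legal = Seq (Assign ''H'' (Var ''m''))
     (For ''j'' (Var ''n'')
       (Seq count_legal (If (Less (Var ''c'') (Var ''H'')) (Assign ''H'' (Var ''c'')) Skip)))"

definition excess_bound :: com where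
  "excess_bound =
     If (Less (Mul (Var ''L'') (Var ''m'')) (Mul (Var ''T'') (Var ''H'')))
       (Assign ''M'' (Mul (Var ''L'') (Var ''m''))) (Assign ''M'' (Mul (Var ''T'') (Var ''H'')))"

definition scheduler :: com where
  "scheduler = Seq scale (Seq min_legal (Seq excess_bound (Seq initial_assignment (Seq auction repair))))"

lemma modified_count_legal [simp]: "modified count_legal = {''c'', ''i''}"
  by (auto simp: count_legal_def)

abbreviation num :: "rat \<Rightarrow> int" where "num r \<equiv> fst (quotient_of r)"
abbreviation den :: "rat \<Rightarrow> int" where "den r \<equiv> snd (quotient_of r)"

definition rat_size :: "rat \<Rightarrow> nat" where
  "rat_size r = bit_length (num r) + bit_length (den r)"

lemma den_pos: "0 < den r"
  by (rule quotient_of_denom_pos')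

lemma of_int_num: "of_int (num r) = of_int (den r) * r"
proof -
  have "r = of_int (num r) / of_int (den r)" by (rule quotient_of_div) simp
  thus ?thesis using den_pos[of r] by (simp add: field_simps)
qed

lemma num_nonneg: "0 \<le> r \<Longrightarrow> 0 \<le> num r"
proof -
  assume "0 \<le> r"
  hence "0 \<le> of_int (den r) * r" using den_pos[of r] by simp
  thus ?thesis by (simp flip: of_int_num)
qed

lemma scaled_num: "den r dvd D \<Longrightarrow> of_int (num r * (D div den r)) = of_int D * r"
proof -
  assume "den r dvd D"
  then obtain c where c: "D = den r * c" by blast
  hence "D div den r = c" using den_pos[of r] by simp
  thus ?thesis using c by (simp add: of_int_num)
qed

section \<open>Size bounds for the scaled data\<close>

locale rational_scheduling =
  fixes m n :: nat and q :: "nat \<Rightarrow> nat \<Rightarrow> rat" and T' L' :: rat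
  assumes m_pos: "0 < m" and n_pos: "0 < n" and q_nonneg: "\<forall>i<m. \<forall>j<n. 0 \<le> q i j"
    and T'_pos: "0 < T'" and L'_pos: "0 < L'"
begin

definition input_bits :: nat where "input_bits = input_size m n q T' L'"
text \<open>Three input lengths hold a scaled number (two of them) times \<open>m\<close>,
  \<open>H\<close> or \<open>n + 1\<close> (the third); the quartic term covers the number of
  auction rounds.\<close>

definition X :: nat where "X = 4 * input_bits ^ 4 + 3 * input_bits + 1"

definition entry_den :: "nat \<Rightarrow> int" where "entry_den k = den (q (k div n) (k mod n))"
definition D :: int where "D = den T' * den L' * (\<Prod>k<m * n. entry_den k)"
definition P :: "nat \<Rightarrow> nat \<Rightarrow> int" where "P i j = num (q i j) * (D div den (q i j))"
definition T :: int where "T = num T' * (D div den T')"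
definition L :: int where "L = num L' * (D div den L')"
definition H :: nat where "H = Min ((\<lambda>j. card {i. i < m \<and> P i j \<le> T}) ` {..<n})"
definition M :: int where "M = min (L * int m) (T * int H)"

lemma size_eq: "input_bits = bit_length (int m) + bit_length (int n) +
    (\<Sum>i<m. \<Sum>j<n. rat_size (q i j)) + rat_size T' + rat_size L'"
  by (simp add: input_bits_def input_size_def Let_def rat_size_def)

lemma mn_le_size: "m * n < input_bits"
proof -
  have "(\<Sum>i<m. \<Sum>j<n. 1) \<le> (\<Sum>i<m. \<Sum>j<n. rat_size (q i j))"
    by (intro sum_mono) (simp add: rat_size_def bit_length_def)
  thus ?thesis by (simp add: size_eq bit_length_def)
qed

lemma m_less_size: "m < input_bits" and n_less_size: "n < input_bits"
proof -
  have "m * 1 \<le> m * n" "1 * n \<le> m * n" using m_pos n_pos by (intro mult_le_mono; simp)+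
  thus "m < input_bits" "n < input_bits" using mn_le_size by linarith+
qed

lemma entry_size: "i < m \<Longrightarrow> j < n \<Longrightarrow> rat_size (q i j) \<le> input_bits"
proof -
  assume "i < m" "j < n"
  hence "rat_size (q i j) \<le> (\<Sum>j<n. rat_size (q i j))" by (intro member_le_sum) auto
  also have "\<dots> \<le> (\<Sum>i<m. \<Sum>j<n. rat_size (q i j))"
    using \<open>i < m\<close> by (intro member_le_sum[where f = "\<lambda>i. \<Sum>j<n. rat_size (q i j)"]) auto
  finally show ?thesis by (simp add: size_eq)
qed

lemma rat_size_bounds:
  assumes "rat_size r \<le> input_bits"
  shows "\<bar>num r\<bar> < 2 ^ input_bits" "\<bar>den r\<bar> < 2 ^ input_bits"
proof -
  have "(2::int) ^ bit_length (num r) \<le> 2 ^ input_bits" "(2::int) ^ bit_length (den r) \<le> 2 ^ input_bits"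
    using assms by (intro power_increasing; simp add: rat_size_def)+
  thus "\<bar>num r\<bar> < 2 ^ input_bits" "\<bar>den r\<bar> < 2 ^ input_bits"
    using abs_less_bit_length[of "num r"] abs_less_bit_length[of "den r"] by linarith+
qed

lemma parameter_size: "rat_size T' \<le> input_bits" "rat_size L' \<le> input_bits"
  by (simp_all add: size_eq)

lemma entry_den_pos: "0 < entry_den k"
  by (simp add: entry_den_def den_pos)

text \<open>Stated for prefixes because the program stores the partial products. A denominator is
  below 2 to the power of its bit length, and these lengths add up to a part of the input
  size.\<close>

lemma partial_D_bounds:
  assumes "k \<le> m * n"
  shows "0 < den T' * den L' * (\<Prod>i<k. entry_den i)" "den T' * den L' * (\<Prod>i<k. entry_den i) < 2 ^ input_bits"
proof -
  show "0 < den T' * den L' * (\<Prod>i<k. entry_den i)"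
    by (intro mult_pos_pos prod_pos) (auto simp: den_pos entry_den_pos)
  have less: "den r < 2 ^ bit_length (den r)" for r
    using abs_less_bit_length[of "den r"] by simp
  have "(\<Prod>i<k. entry_den i) \<le> (\<Prod>i<k. 2 ^ bit_length (entry_den i))"
    using less entry_den_pos by (intro prod_mono) (auto simp: entry_den_def order_less_imp_le)
  also have "\<dots> = 2 ^ (\<Sum>i<k. bit_length (entry_den i))" by (simp add: power_sum)
  finally have prod: "(\<Prod>i<k. entry_den i) \<le> 2 ^ (\<Sum>i<k. bit_length (entry_den i))" .
  have "den T' * den L' * (\<Prod>i<k. entry_den i) <
      2 ^ bit_length (den T') * 2 ^ bit_length (den L') * 2 ^ (\<Sum>i<k. bit_length (entry_den i))"
    using less[of T'] less[of L'] prod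
    by (intro mult_less_le_imp_less mult_strict_mono prod_pos mult_pos_pos mult_nonneg_nonneg)
      (auto simp: den_pos entry_den_pos order_less_imp_le)
  also have "\<dots> = 2 ^ (bit_length (den T') + bit_length (den L') + (\<Sum>i<k. bit_length (entry_den i)))"
    by (simp add: power_add)
  also have "\<dots> \<le> 2 ^ input_bits"
  proof (intro power_increasing)
    have "(\<Sum>i<k. bit_length (entry_den i)) \<le> (\<Sum>i<m * n. bit_length (entry_den i))"
      using assms by (intro sum_mono2) auto
    also have "\<dots> = (\<Sum>i<m. \<Sum>j<n. bit_length (den (q i j)))"
      unfolding entry_den_def using sum_row_major[where f = "\<lambda>i j. bit_length (den (q i j))"] by simp
    also have "\<dots> \<le> (\<Sum>i<m. \<Sum>j<n. rat_size (q i j))" by (intro sum_mono) (simp add: rat_size_def)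
    finally show "bit_length (den T') + bit_length (den L') + (\<Sum>i<k. bit_length (entry_den i)) \<le> input_bits"
      by (simp add: size_eq rat_size_def)
  qed simp
  finally show "den T' * den L' * (\<Prod>i<k. entry_den i) < 2 ^ input_bits" .
qed

lemma D_pos: "0 < D" and D_less: "D < 2 ^ input_bits"
  using partial_D_bounds[of "m * n"] by (simp_all add: D_def)

lemma index_less: "i < m \<Longrightarrow> j < n \<Longrightarrow> i * n + j < m * n"
proof -
  assume "i < m" "j < n"
  hence "i * n + j < Suc i * n" by simp
  also have "\<dots> \<le> m * n" using \<open>i < m\<close> by (intro mult_le_mono) auto
  finally show ?thesis .
qed

lemma entry_den_index: "i < m \<Longrightarrow> j < n \<Longrightarrow> entry_den (i * n + j) = den (q i j)"
  by (simp add: entry_den_def)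

lemma den_dvd_D: "i < m \<Longrightarrow> j < n \<Longrightarrow> den (q i j) dvd D" "den T' dvd D" "den L' dvd D"
proof -
  show "den (q i j) dvd D" if "i < m" "j < n"
  proof -
    have "entry_den (i * n + j) dvd (\<Prod>k<m * n. entry_den k)"
      using index_less[OF that] by (intro dvd_prodI) auto
    thus ?thesis using entry_den_index[OF that] by (simp add: D_def)
  qed
qed (simp_all add: D_def)

lemma of_int_P: "i < m \<Longrightarrow> j < n \<Longrightarrow> of_int (P i j) = of_int D * q i j"
  unfolding P_def by (rule scaled_num) (rule den_dvd_D)

lemma of_int_T: "of_int T = of_int D * T'" and of_int_L: "of_int L = of_int D * L'"
  unfolding T_def L_def by (rule scaled_num, rule den_dvd_D)+

lemma scaled_bounds:
  assumes "0 \<le> r" "rat_size r \<le> input_bits"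
  shows "0 \<le> num r * (D div den r)" "num r * (D div den r) \<le> 2 ^ (2 * input_bits)"
proof -
  have d: "0 \<le> D div den r" "D div den r < 2 ^ input_bits"
    using D_pos den_pos[of r] abs_div_le[of D "den r"] D_less by (auto simp: pos_imp_zdiv_nonneg_iff)
  have nm: "0 \<le> num r" "num r < 2 ^ input_bits" using num_nonneg[OF assms(1)] rat_size_bounds[OF assms(2)] by auto
  show "0 \<le> num r * (D div den r)" using d nm by simp
  have "num r * (D div den r) \<le> 2 ^ input_bits * 2 ^ input_bits" using d nm by (intro mult_mono) auto
  thus "num r * (D div den r) \<le> 2 ^ (2 * input_bits)" by (simp add: mult_2 power_add)
qed

lemma TL_bounds: "0 \<le> T" "T \<le> 2 ^ (2 * input_bits)" "0 \<le> L" "L \<le> 2 ^ (2 * input_bits)"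
  using scaled_bounds[of T'] scaled_bounds[of L'] T'_pos L'_pos parameter_size by (simp_all add: T_def L_def)

lemma H_le: "H \<le> m"
proof -
  have "H \<le> card {i. i < m \<and> P i 0 \<le> T}" unfolding H_def using n_pos by (intro Min_le) auto
  also have "\<dots> \<le> card {..<m}" by (intro card_mono) auto
  finally show ?thesis by simp
qed

lemma X_ge: "3 * input_bits + 1 \<le> X" "m * ((m + 1) * m) * (n + 1) + n + 1 \<le> X"
proof -
  show "3 * input_bits + 1 \<le> X" by (simp add: X_def)
  have "m * ((m + 1) * m) * (n + 1) \<le> input_bits * (input_bits * input_bits) * input_bits"
    using m_less_size n_less_size by (intro mult_le_mono) auto
  also have "\<dots> = input_bits ^ 4" by (simp add: eval_nat_numeral)
  finally show "m * ((m + 1) * m) * (n + 1) + n + 1 \<le> X" using n_less_size by (simp add: X_def)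
qed

lemma triple_size_less: "(v :: int) \<le> 2 ^ (2 * input_bits) * 2 ^ input_bits \<Longrightarrow> v < 2 ^ X"
proof -
  assume "v \<le> 2 ^ (2 * input_bits) * 2 ^ input_bits"
  also have "(2::int) ^ (2 * input_bits) * 2 ^ input_bits = 2 ^ (3 * input_bits)" by (simp flip: power_add)
  also have "\<dots> < 2 ^ X" using X_ge(1) by (intro power_strict_increasing) auto
  finally show ?thesis .
qed

lemma int_size_power: "k \<le> input_bits \<Longrightarrow> int k \<le> 2 ^ input_bits"
  by (metis less_exp le_less_trans order_less_imp_le of_nat_le_numeral_power_cancel_iff)

sublocale int_scheduling m n P T L M H X "2 ^ (2 * input_bits)"
proof
  show "0 < m" "0 < n" using m_pos n_pos .
  show "\<forall>i<m. \<forall>j<n. 0 \<le> P i j" "\<forall>i<m. \<forall>j<n. P i j \<le> 2 ^ (2 * input_bits)"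
    using scaled_bounds q_nonneg entry_size by (auto simp: P_def)
  have "int (n + 1) \<le> 2 ^ input_bits" using n_less_size by (intro int_size_power) simp
  hence "(int n + 1) * 2 ^ (2 * input_bits) \<le> 2 ^ input_bits * 2 ^ (2 * input_bits)" by (intro mult_right_mono) auto
  thus "(int n + 1) * 2 ^ (2 * input_bits) < 2 ^ X" by (intro triple_size_less) (simp add: mult.commute)
  show "M = min (L * int m) (T * int H)" by (rule M_def)
  show "m * ((m + 1) * m) * (n + 1) + n + 1 \<le> X" by (rule X_ge)
qed

section \<open>Execution of the program on rational input\<close>

abbreviation s0 :: state where "s0 \<equiv> input_state m n q T' L'"

lemma size_less_X: "v < 2 ^ input_bits \<Longrightarrow> (v::int) < 2 ^ X"
proof -
  assume "v < 2 ^ input_bits"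
  also have "(2::int) ^ input_bits \<le> 2 ^ X" using X_ge(1) by (intro power_increasing) auto
  finally show ?thesis .
qed

lemma bounded_input: "bounded X s0"
proof -
  have idx: "\<bar>num (q (nat k div n) (nat k mod n))\<bar> < 2 ^ X" "\<bar>den (q (nat k div n) (nat k mod n))\<bar> < 2 ^ X"
    if "0 \<le> k" "k < int m * int n" for k
  proof -
    have "nat k < m * n" using that by (simp add: nat_less_iff)
    hence "nat k div n < m" "nat k mod n < n" using n_pos by (auto simp: less_mult_imp_div_less)
    from rat_size_bounds[OF entry_size[OF this]] show "\<bar>num (q (nat k div n) (nat k mod n))\<bar> < 2 ^ X"
      "\<bar>den (q (nat k div n) (nat k mod n))\<bar> < 2 ^ X" by (auto intro: size_less_X)
  qed
  have par: "\<bar>num T'\<bar> < 2 ^ X" "\<bar>den T'\<bar> < 2 ^ X" "\<bar>num L'\<bar> < 2 ^ X" "\<bar>den L'\<bar> < 2 ^ X"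
    using rat_size_bounds parameter_size by (auto intro: size_less_X)
  show ?thesis unfolding bounded_def input_state_def
    using idx par X_bounds int_less_power by (auto simp: scalar_def matrix_def)
qed

lemma input_entries:
  assumes "k < m * n"
  shows "s0 ''p_num'' (int k) = num (q (k div n) (k mod n))" "s0 ''p_den'' (int k) = entry_den k"
  using assms by (auto simp: input_state_def matrix_def entry_den_def simp flip: of_nat_mult)

lemma input_scalars:
  "s0 ''m'' 0 = int m" "s0 ''n'' 0 = int n" "s0 ''T_num'' 0 = num T'" "s0 ''T_den'' 0 = den T'"
  "s0 ''L_num'' 0 = num L'" "s0 ''L_den'' 0 = den L'"
  "s0 ''alpha'' = (\<lambda>_. 0)" "s0 ''w'' = (\<lambda>_. 0)" "s0 ''ld'' = (\<lambda>_. 0)"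
  by (simp_all add: input_state_def scalar_def)

lemma mn_le_X: "m * n \<le> X"
  using mn_le_size X_ge(1) by simp

lemma wp_scale:
  assumes Q: "\<And>s. (\<And>z. z \<notin> {''D'', ''k'', ''P'', ''T'', ''L''} \<Longrightarrow> s z = s0 z) \<Longrightarrow>
    (\<forall>k<m * n. s ''P'' (int k) = P (k div n) (k mod n)) \<Longrightarrow> s ''T'' 0 = T \<Longrightarrow> s ''L'' 0 = L \<Longrightarrow> Q s"
  shows "wp X scale Q s0"
  unfolding scale_def
proof (intro wp_Seq[OF wp_Store], goal_cases)
  case 1
  show ?case using partial_D_bounds[of 0] by (simp add: input_scalars size_less_X)
next
  case 2
  show ?case
  proof (rule wp_Seq, rule wp_For[where N = "m * n" and
        I = "\<lambda>k s. s ''D'' 0 = den T' * den L' * (\<Prod>i<k. entry_den i)"], goal_cases)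
    case (3 s)
    thus ?case by (simp add: input_scalars)
  next
    case 4
    show ?case by (simp add: input_scalars)
  next
    case (5 k s)
    have val: "aval (Mul (Var ''D'') (Load ''p_den'' (Var ''k''))) s = den T' * den L' * (\<Prod>i<Suc k. entry_den i)"
      using 5(1,2,4) by (simp add: 5(3) input_entries mult.assoc)
    show ?case
    proof (rule wp_Store)
      show "\<bar>aval (Mul (Var ''D'') (Load ''p_den'' (Var ''k''))) s\<bar> < 2 ^ X"
        unfolding val using partial_D_bounds[of "Suc k"] 5(1) by (simp add: size_less_X del: prod.lessThan_Suc)
    qed (simp only: val, simp)
  next
    case (6 s1)
    hence fr1: "s1 z = s0 z" if "z \<notin> {''D'', ''k''}" for z using that by auto
    have D1: "s1 ''D'' 0 = D" using 6 by (simp add: D_def)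
    show ?case
    proof (rule wp_Seq, rule wp_For[where N = "m * n" and
          I = "\<lambda>k s. \<forall>i<k. s ''P'' (int i) = P (i div n) (i mod n)"], goal_cases)
      case (3 s)
      thus ?case by (simp add: fr1 input_scalars)
    next
      case (5 k s)
      have idx: "k div n < m" "k mod n < n" using 5(1) n_pos by (auto simp: less_mult_imp_div_less)
      have val: "aval (Mul (Load ''p_num'' (Var ''k'')) (Div (Var ''D'') (Load ''p_den'' (Var ''k'')))) s
          = P (k div n) (k mod n)"
        using 5(1,2) by (simp add: 5(3) fr1 D1 input_entries P_def entry_den_def)
      have "P (k div n) (k mod n) * 1 \<le> 2 ^ (2 * input_bits) * 2 ^ input_bits"
        using P_nonneg P_le idx by (intro mult_mono) auto
      hence bd: "\<bar>P (k div n) (k mod n)\<bar> < 2 ^ X" using P_nonneg idx triple_size_less by simp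
      show ?case
        by (rule wp_Store) (unfold val, use bd 5(2,4) in \<open>auto simp: less_Suc_eq\<close>)
    next
      case (6 s2)
      hence fr2: "s2 z = s0 z" if "z \<notin> {''D'', ''k'', ''P''}" for z using that fr1 by auto
      have D2: "s2 ''D'' 0 = D" using 6(1) D1 by simp
      have "T * 1 \<le> 2 ^ (2 * input_bits) * 2 ^ input_bits" "L * 1 \<le> 2 ^ (2 * input_bits) * 2 ^ input_bits"
        by (rule mult_mono; simp add: TL_bounds)+
      hence bd: "\<bar>T\<bar> < 2 ^ X" "\<bar>L\<bar> < 2 ^ X" using triple_size_less TL_bounds by simp_all
      show ?case
      proof (intro wp_Seq[OF wp_Store] wp_Store, goal_cases)
        case 1
        thus ?case using bd by (simp add: fr2 D2 input_scalars T_def)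
      next
        case 2
        thus ?case using bd by (simp add: fr2 D2 input_scalars L_def)
      next
        case 3
        show ?case
          by (rule Q) (use 6(2) in \<open>simp_all add: fr2 D2 input_scalars T_def L_def\<close>)
      qed
    qed (use mn_le_X in auto)
  qed (use mn_le_X in auto)
qed

lemma wp_count_legal:
  assumes "s ''m'' 0 = int m" "s ''n'' 0 = int n" "s ''T'' 0 = T" "s ''j'' 0 = int j" "j < n"
    "\<forall>i<m. s ''P'' (int i * int n + int j) = P i j"
    and Q: "\<And>s'. (\<And>z. z \<notin> {''c'', ''i''} \<Longrightarrow> s' z = s z) \<Longrightarrow>
      s' ''c'' 0 = int (card {i. i < m \<and> P i j \<le> T}) \<Longrightarrow> Q s'"
  shows "wp X count_legal Q s"
  unfolding count_legal_def
proof (intro wp_Seq[OF wp_Store], goal_cases)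
  case 2
  show ?case
  proof (rule wp_For[where N = m and I = "\<lambda>k s. s ''c'' 0 = int (card {i. i < k \<and> P i j \<le> T})"], goal_cases)
    case (3 s')
    thus ?case using assms(1) by simp
  next
    case (5 k s')
    have E: "s' ''P'' (s' ''i'' 0 * s' ''n'' 0 + s' ''j'' 0) = P k j"
      using assms 5(1,2) by (simp add: 5(3))
    have T: "s' ''T'' 0 = T" using assms(3) by (simp add: 5(3))
    show ?case
    proof (intro wp_If wp_Skip wp_Store, goal_cases)
      case 1
      hence "{i. i < Suc k \<and> P i j \<le> T} = {i. i < k \<and> P i j \<le> T}" using E T by (auto simp: less_Suc_eq)
      thus ?case using 5(4) by simp
    next
      case 2
      have "card {i. i < k \<and> P i j \<le> T} \<le> card {..<k}" by (intro card_mono) auto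
      hence "int (card {i. i < k \<and> P i j \<le> T} + 1) < 2 ^ X" using X_bounds 5(1) by (intro int_less_power) simp
      thus ?case using 5(4) by simp
    next
      case 3
      hence "{i. i < Suc k \<and> P i j \<le> T} = insert k {i. i < k \<and> P i j \<le> T}" using E T by (auto simp: less_Suc_eq)
      thus ?case using 5(4) by simp
    qed
  next
    case (6 s')
    have "s' z = s z" if "z \<notin> {''c'', ''i''}" for z using that 6(1)[of z] by auto
    from Q[OF this 6(2)] show ?case by blast
  qed (use X_bounds in auto)
qed simp

lemma wp_min_legal:
  assumes "s ''m'' 0 = int m" "s ''n'' 0 = int n" "s ''T'' 0 = T"
    "\<forall>i<m. \<forall>j<n. s ''P'' (int i * int n + int j) = P i j"
    and Q: "\<And>s'. (\<And>z. z \<notin> {''c'', ''i'', ''j'', ''H''} \<Longrightarrow> s' z = s z) \<Longrightarrow> s' ''H'' 0 = int H \<Longrightarrow> Q s'"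
  shows "wp X min_legal Q s"
  unfolding min_legal_def
proof (intro wp_Seq[OF wp_Store], goal_cases)
  case 1
  show ?case using assms(1) X_bounds int_less_power[of m] by simp
next
  case 2
  let ?c = "\<lambda>j. card {i. i < m \<and> P i j \<le> T}"
  show ?case
  proof (rule wp_For[where N = n and I = "\<lambda>k s. s ''H'' 0 = int (Min (insert m (?c ` {..<k})))"], goal_cases)
    case (3 s')
    thus ?case using assms(2) by simp
  next
    case 4
    show ?case using assms(1) by simp
  next
    case (5 k s')
    define v where "v = Min (insert m (?c ` {..<k}))"
    have Min: "Min (insert m (?c ` {..<Suc k})) = min (?c k) v"
      unfolding v_def
      by (subst Min_insert[symmetric]) (auto simp: lessThan_Suc insert_commute simp del: Min_insert)
    show ?case
    proof (rule wp_Seq, rule wp_count_legal[where j = k], goal_cases)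
      case (7 s'')
      have H: "s'' ''H'' 0 = int v" using 5(4) by (simp add: 7(1) v_def)
      show ?case
      proof (intro wp_If wp_Skip wp_Store, goal_cases)
        case 1
        have "?c k \<le> card {..<m}" by (intro card_mono) auto
        hence "int (?c k) < 2 ^ X" using X_bounds by (intro int_less_power) simp
        thus ?case using 7(2) by simp
      next
        case 2
        hence "?c k < v" using 7(2) H by simp
        thus ?case using 7(2) by (simp add: Min del: Min_insert)
      next
        case 3
        hence "v \<le> ?c k" using 7(2) H by simp
        thus ?case using H by (simp add: Min del: Min_insert)
      qed
    qed (use assms 5 in simp_all)
  next
    case (6 s')
    have fr: "s' z = s z" if "z \<notin> {''c'', ''i'', ''j'', ''H''}" for z using that 6(1)[of z] by auto
    have "Min (insert m (?c ` {..<n})) = min m H"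
      unfolding H_def using n_pos by (subst Min_insert) auto
    thus ?case using Q[OF fr] 6(2) H_le by simp
  qed (use X_bounds in auto)
qed

text \<open>Termination within the time bound is unconditional and only the quality of the result
  depends on \<open>feasible\<close>, so this serves both halves of the theorem.\<close>

lemma wp_scheduler:
  "wp X scheduler (\<lambda>s. \<exists>\<alpha>. (\<forall>j<n. s ''alpha'' (int j) = int (\<alpha> j) \<and> \<alpha> j < m) \<and>
     (feasible \<longrightarrow> feasible_scheduling.solves m n P T L H \<alpha>)) s0"
  unfolding scheduler_def
proof (rule wp_Seq, rule wp_scale, goal_cases)
  case (1 s1)
  have P1: "\<forall>i<m. \<forall>j<n. s1 ''P'' (int i * int n + int j) = P i j"
  proof (intro allI impI)
    fix i j assume "i < m" "j < n"
    with 1(2) index_less[of i j] have "s1 ''P'' (int (i * n + j)) = P ((i * n + j) div n) ((i * n + j) mod n)" by blast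
    thus "s1 ''P'' (int i * int n + int j) = P i j" using \<open>j < n\<close> by simp
  qed
  show ?case
  proof (rule wp_Seq, rule wp_min_legal, goal_cases)
    case (5 s2)
    have "L * int m \<le> 2 ^ (2 * input_bits) * 2 ^ input_bits" "T * int H \<le> 2 ^ (2 * input_bits) * 2 ^ input_bits" "0 \<le> L" "0 \<le> T"
      using TL_bounds int_size_power[of m] int_size_power[of H] m_less_size H_le
      by (auto intro!: mult_mono)
    hence bd: "\<bar>L * int m\<bar> < 2 ^ X" "\<bar>T * int H\<bar> < 2 ^ X" using triple_size_less by simp_all
    have s2: "s2 ''L'' 0 = L" "s2 ''T'' 0 = T" "s2 ''m'' 0 = int m" "s2 ''n'' 0 = int n"
      using 1 by (simp_all add: 5(1) input_scalars)
    have "wp X excess_bound (\<lambda>s3. s3 ''M'' 0 = M) s2"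
      unfolding excess_bound_def
      by (intro wp_If wp_Store) (use bd in \<open>auto simp: s2 5(2) M_def\<close>)
    from wp_frame[OF this] show ?case
    proof (rule wp_Seq[OF wp_mono], goal_cases)
      case (1 s3)
      have fr3: "s3 z = s2 z" if "z \<noteq> ''M''" for z using 1 that by (simp add: excess_bound_def)
      have base3: "base s3" using 1 s2 P1 by (simp add: base_def fr3 5)
      have z3: "s3 ''alpha'' = (\<lambda>_. 0)" "s3 ''w'' = (\<lambda>_. 0)" "s3 ''ld'' = (\<lambda>_. 0)"
        using \<open>\<And>z. z \<notin> {''D'', ''k'', ''P'', ''T'', ''L''} \<Longrightarrow> s1 z = s0 z\<close>
        by (simp_all add: fr3 5(1) input_scalars)
      show ?case
      proof (rule wp_Seq, rule wp_initial_assignment[OF base3 z3], goal_cases)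
        case (1 s4 \<alpha>)
        have base4: "base s4" using base3 by (simp add: base_def 1(1))
        show ?case
        proof (rule wp_Seq, rule wp_auction[OF base4 1(2,3)], goal_cases)
          case (2 s5 \<alpha>' l')
          have base5: "base s5" using base4 by (simp add: base_def 2(1))
          show ?case
            by (rule wp_repair[OF base5 2(2,3)]) (auto simp: conf_def)
        qed
      qed
    qed
  qed (use 1 P1 in \<open>simp_all add: input_scalars\<close>)
qed

end

section \<open>From the scaled integers back to the real-valued statement\<close>

lemma solves_makespan:
  fixes p :: "nat \<Rightarrow> nat \<Rightarrow> real"
  assumes "feasible_scheduling m n p T L H" "feasible_scheduling.solves m n p T L H \<alpha>"
    and h: "h = real H / real m"
  shows "is_assignment m n \<alpha>" and "makespan m n p \<alpha> \<le> min (T + L / h) (2 * T)"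
proof -
  interpret feasible_scheduling m n p T L H by fact
  show "is_assignment m n \<alpha>" using assms(2) by (simp add: is_assignment_def solves_def)
  have "load n p \<alpha> i \<le> min (T + L / h) (2 * T)" if "i < m" for i
  proof -
    have "real H * ld \<alpha> i \<le> real H * T + L * real m" "ld \<alpha> i \<le> 2 * T"
      using assms(2) that by (auto simp: solves_def)
    moreover have "T + L / h = (real H * T + L * real m) / real H"
      using H_pos m_pos by (simp add: h field_simps)
    ultimately have "ld \<alpha> i \<le> T + L / h" using H_pos by (simp add: pos_le_divide_eq mult.commute)
    thus ?thesis using \<open>ld \<alpha> i \<le> 2 * T\<close> by (simp add: load_def machine_load_def)
  qed
  thus "makespan m n p \<alpha> \<le> min (T + L / h) (2 * T)"
    unfolding makespan_def using m_pos by (subst Max_le_iff) auto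
qed

lemma lp_feasible_scheduling:
  fixes p :: "nat \<Rightarrow> nat \<Rightarrow> real"
  assumes "is_instance m n p" "0 < T" "0 < L" "L \<le> T" "lp_feasible m n p T L"
    and H: "H = Min ((\<lambda>j. card {i. i < m \<and> p i j \<le> T}) ` {..<n})" "0 < H"
  shows "feasible_scheduling m n p T L H"
proof
  have n: "0 < n" and p: "\<forall>i<m. \<forall>j<n. 0 \<le> p i j" using assms(1) by (auto simp: is_instance_def)
  show "\<forall>i<m. \<forall>j<n. 0 \<le> p i j" by (rule p)
  show legal: "\<forall>j<n. H \<le> card {i. i < m \<and> p i j \<le> T}" unfolding H(1) by (auto intro!: Min_le)
  have "H \<le> card {i. i < m \<and> p i 0 \<le> T}" using legal n by blast
  also have "\<dots> \<le> card {..<m}" by (intro card_mono) auto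
  finally show "H \<le> m" by simp
  fix l :: "nat \<Rightarrow> nat" and c
  assume "\<forall>i<m. \<forall>j<n. p i j \<le> T \<longrightarrow> c j \<le> real (l i + m + 1) * p i j"
  from lp_feasible_dual[OF assms(5) p this]
  show "(\<Sum>j<n. c j) \<le> T * (\<Sum>i<m. real (l i)) + real (m + 1) * real m * L" .
qed (use assms in auto)

text \<open>All conditions are homogeneous in processing times, \<open>T\<close> and
  \<open>L\<close>. Integer dual variables \<open>c\<close> are divided by \<open>D\<close> to use
  the real duality inequality, whose sides are then multiplied by \<open>D\<close> again.\<close>

lemma feasible_scheduling_scale:
  fixes p :: "nat \<Rightarrow> nat \<Rightarrow> real" and T L :: real and P :: "nat \<Rightarrow> nat \<Rightarrow> int" and D Ti Li :: int
  assumes real: "feasible_scheduling m n p T L H" and "0 < D"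
    and P: "\<And>i j. i < m \<Longrightarrow> j < n \<Longrightarrow> real_of_int (P i j) = D * p i j"
    and Ti: "real_of_int Ti = D * T" and Li: "real_of_int Li = D * L"
  shows "feasible_scheduling m n P Ti Li H"
    and "feasible_scheduling.solves m n P Ti Li H \<alpha> \<Longrightarrow> feasible_scheduling.solves m n p T L H \<alpha>"
proof -
  interpret R: feasible_scheduling m n p T L H by (rule real)
  have D: "0 < real_of_int D" using \<open>0 < D\<close> by simp
  have cmp: "P i j \<le> Ti \<longleftrightarrow> p i j \<le> T" if "i < m" "j < n" for i j
  proof -
    have "P i j \<le> Ti \<longleftrightarrow> real_of_int (P i j) \<le> real_of_int Ti" by simp
    also have "\<dots> \<longleftrightarrow> p i j \<le> T" unfolding P[OF that] Ti using D by simp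
    finally show ?thesis .
  qed
  show int: "feasible_scheduling m n P Ti Li H"
  proof
    show "\<forall>i<m. \<forall>j<n. 0 \<le> P i j"
    proof (intro allI impI)
      fix i j assume ij: "i < m" "j < n"
      have "0 \<le> real_of_int (P i j)" unfolding P[OF ij] using D R.p_nonneg ij by simp
      thus "0 \<le> P i j" by simp
    qed
    have "0 < real_of_int Ti" "0 < real_of_int Li" "real_of_int Li \<le> real_of_int Ti"
      unfolding Ti Li using D R.T_pos R.L_pos R.L_le_T by auto
    thus "0 < Ti" "0 < Li" "Li \<le> Ti" by simp_all
    show "0 < H" "H \<le> m" by (rule R.H_pos R.H_le)+
    have "{i. i < m \<and> P i j \<le> Ti} = {i. i < m \<and> p i j \<le> T}" if "j < n" for j using cmp that by auto
    thus "\<forall>j<n. H \<le> card {i. i < m \<and> P i j \<le> Ti}" using R.legal_card by simp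
    fix l :: "nat \<Rightarrow> nat" and c
    assume c: "\<forall>i<m. \<forall>j<n. P i j \<le> Ti \<longrightarrow> c j \<le> int (l i + m + 1) * P i j"
    have "(\<Sum>j<n. real_of_int (c j) / D) \<le> T * (\<Sum>i<m. real (l i)) + real (m + 1) * real m * L"
    proof (intro R.dual allI impI)
      fix i j assume ij: "i < m" "j < n" "p i j \<le> T"
      hence "c j \<le> int (l i + m + 1) * P i j" using c cmp by blast
      hence "real_of_int (c j) \<le> real_of_int (int (l i + m + 1) * P i j)" by (simp only: of_int_le_iff)
      also have "\<dots> = real (l i + m + 1) * (D * p i j)" using P[OF ij(1,2)] by simp
      finally show "real_of_int (c j) / D \<le> real (l i + m + 1) * p i j" using D by (simp add: field_simps)
    qed
    hence "(\<Sum>j<n. real_of_int (c j)) / D \<le> T * (\<Sum>i<m. real (l i)) + real (m + 1) * real m * L"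
      by (simp add: sum_divide_distrib)
    hence "(\<Sum>j<n. real_of_int (c j)) \<le> (T * (\<Sum>i<m. real (l i)) + real (m + 1) * real m * L) * D"
      using D by (simp add: pos_divide_le_eq)
    also have "\<dots> = (D * T) * (\<Sum>i<m. real (l i)) + real (m + 1) * real m * (D * L)"
      by (simp add: algebra_simps)
    also have "\<dots> = real_of_int (Ti * (\<Sum>i<m. int (l i)) + int (m + 1) * int m * Li)"
      unfolding Ti[symmetric] Li[symmetric] by simp
    finally show "(\<Sum>j<n. c j) \<le> Ti * (\<Sum>i<m. int (l i)) + int (m + 1) * int m * Li"
      by (simp only: of_int_sum[symmetric] of_int_le_iff)
  qed
  interpret I: feasible_scheduling m n P Ti Li H by (rule int)
  assume "I.solves \<alpha>"
  have "real H * R.ld \<alpha> i \<le> real H * T + L * real m \<and> R.ld \<alpha> i \<le> 2 * T" if "i < m" for i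
  proof -
    have ld: "real_of_int (I.ld \<alpha> i) = D * R.ld \<alpha> i"
      unfolding machine_load_def using P that by (simp add: sum_distrib_left)
    have "int H * I.ld \<alpha> i \<le> int H * Ti + Li * int m" "I.ld \<alpha> i \<le> 2 * Ti"
      using \<open>I.solves \<alpha>\<close> that by (auto simp: I.solves_def)
    hence "real_of_int (int H * I.ld \<alpha> i) \<le> real_of_int (int H * Ti + Li * int m)"
      "real_of_int (I.ld \<alpha> i) \<le> real_of_int (2 * Ti)" by (simp_all only: of_int_le_iff)
    hence "D * (real H * R.ld \<alpha> i) \<le> D * (real H * T + L * real m)" "D * R.ld \<alpha> i \<le> D * (2 * T)"
      by (simp_all add: ld Ti Li algebra_simps)
    thus ?thesis using D by (simp only: mult_le_cancel_left_pos)
  qed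
  thus "R.solves \<alpha>" using \<open>I.solves \<alpha>\<close> by (simp add: R.solves_def I.solves_def)
qed

lemma polynomial_time_scheduler: "polynomial_time scheduler"
proof -
  obtain f :: "nat poly" where f: "\<And>X. time_bound X scheduler = poly f X"
    using time_bound_poly by blast
  \<comment> \<open>The word length \<open>X\<close> as a polynomial in the input size, constant
    coefficient first.\<close>
  define g :: "nat poly" where "g = [:1, 3, 0, 0, 4:]"
  show ?thesis unfolding polynomial_time_def
  proof (intro exI[of _ "pcompose f g"] allI impI)
    fix m n :: nat and q :: "nat \<Rightarrow> nat \<Rightarrow> rat" and T L :: rat
    assume a: "is_instance m n (\<lambda>i j. real_of_rat (q i j)) \<and> 0 < T \<and> 0 < L \<and> L \<le> T"
    interpret rational_scheduling m n q T L
      by standard (use a in \<open>auto simp: is_instance_def\<close>)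
    have "poly g input_bits = X"
      by (simp add: g_def X_def eval_nat_numeral algebra_simps)
    hence "time_bound X scheduler = poly (pcompose f g) (input_size m n q T L)"
      by (simp add: f poly_pcompose flip: input_bits_def)
    thus "\<exists>t s. exec scheduler (input_state m n q T L) t s \<and> t \<le> poly (pcompose f g) (input_size m n q T L)"
      using wp_scheduler bounded_input unfolding wp_def by metis
  qed
qed

text \<open>In the theorem one assignment must be the output for every rational \<open>q\<close>
  that represents the data, and such a \<open>q\<close> is arbitrary outside the index range; the
  input memory does not see that part.\<close>

lemma input_state_cong:
  assumes "\<forall>i<m. \<forall>j<n. q i j = q' i j"
  shows "input_state m n q T L = input_state m n q' T L"
proof -
  have "matrix m n (\<lambda>i j. f (q i j)) = matrix m n (\<lambda>i j. f (q' i j))" for f :: "rat \<Rightarrow> int"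
  proof
    fix k
    have "nat k div n < m \<and> nat k mod n < n" if "0 \<le> k" "k < int (m * n)"
    proof -
      have "nat k < m * n" using that by (simp add: nat_less_iff)
      thus ?thesis by (cases "n = 0") (auto simp: less_mult_imp_div_less)
    qed
    thus "matrix m n (\<lambda>i j. f (q i j)) k = matrix m n (\<lambda>i j. f (q' i j)) k"
      using assms by (simp add: matrix_def)
  qed
  from this[of num] this[of den] show ?thesis by (simp add: input_state_def)
qed

lemma scheduler_correct:
  fixes p :: "nat \<Rightarrow> nat \<Rightarrow> real"
  assumes feas: "feasible_scheduling m n p (real_of_rat T) (real_of_rat L) H" and "0 < n"
    and q: "\<forall>i<m. \<forall>j<n. p i j = real_of_rat (q i j)"
    and H: "H = Min ((\<lambda>j. card {i. i < m \<and> p i j \<le> real_of_rat T}) ` {..<n})"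
  shows "\<exists>\<alpha>. feasible_scheduling.solves m n p (real_of_rat T) (real_of_rat L) H \<alpha> \<and> outputs scheduler m n q T L \<alpha>"
proof -
  interpret R: feasible_scheduling m n p "real_of_rat T" "real_of_rat L" H by (rule feas)
  interpret I: rational_scheduling m n q T L
    by standard (use R.m_pos \<open>0 < n\<close> R.p_nonneg q R.T_pos R.L_pos in auto)
  have P: "real_of_int (I.P i j) = I.D * p i j" if "i < m" "j < n" for i j
  proof -
    have "real_of_rat (of_int (I.P i j)) = real_of_rat (of_int I.D * q i j)" using I.of_int_P[OF that] by simp
    thus ?thesis using q that by (simp add: of_rat_mult)
  qed
  have T: "real_of_int I.T = I.D * real_of_rat T"
    using arg_cong[OF I.of_int_T, of real_of_rat] by (simp add: of_rat_mult)
  have L: "real_of_int I.L = I.D * real_of_rat L"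
    using arg_cong[OF I.of_int_L, of real_of_rat] by (simp add: of_rat_mult)
  have "I.P i j \<le> I.T \<longleftrightarrow> p i j \<le> real_of_rat T" if "i < m" "j < n" for i j
  proof -
    have "I.P i j \<le> I.T \<longleftrightarrow> real_of_int (I.P i j) \<le> real_of_int I.T" by simp
    also have "\<dots> \<longleftrightarrow> p i j \<le> real_of_rat T" unfolding P[OF that] T using I.D_pos by simp
    finally show ?thesis .
  qed
  hence "{i. i < m \<and> I.P i j \<le> I.T} = {i. i < m \<and> p i j \<le> real_of_rat T}" if "j < n" for j using that by auto
  hence H: "I.H = H" unfolding I.H_def H by (intro arg_cong[of _ _ Min] image_cong) auto
  note scaled = feasible_scheduling_scale[OF feas I.D_pos P T L]
  obtain t s \<alpha> where "exec scheduler I.s0 t s" "\<forall>j<n. s ''alpha'' (int j) = int (\<alpha> j) \<and> \<alpha> j < m"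
    "I.feasible \<longrightarrow> feasible_scheduling.solves m n I.P I.T I.L I.H \<alpha>"
    using I.wp_scheduler I.bounded_input unfolding wp_def by blast
  thus ?thesis using scaled unfolding H outputs_def by blast
qed

theorem theorem1:
  "\<exists>A. polynomial_time A \<and>
     (\<forall>(m :: nat) (n :: nat) (p :: nat \<Rightarrow> nat \<Rightarrow> real) (T :: real) (L :: real) (h :: real).
        is_instance m n p \<and> 0 < T \<and> 0 < L \<and> L \<le> T \<and>
        h = feasibility_factor m n p T \<and> 0 < h \<and> h \<le> 1 \<and>
        lp_feasible m n p T L \<longrightarrow>
        (\<exists>\<alpha>. is_assignment m n \<alpha> \<and>
             makespan m n p \<alpha> \<le> min (T + L / h) (2 * T) \<and>
             (\<forall>q T' L'. (\<forall>i<m. \<forall>j<n. p i j = real_of_rat (q i j)) \<and>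
                        T = real_of_rat T' \<and> L = real_of_rat L' \<longrightarrow>
                        outputs A m n q T' L' \<alpha>)))"
proof (intro exI[of _ scheduler] conjI allI impI polynomial_time_scheduler)
  fix m n :: nat and p :: "nat \<Rightarrow> nat \<Rightarrow> real" and T L h :: real
  assume a: "is_instance m n p \<and> 0 < T \<and> 0 < L \<and> L \<le> T \<and>
    h = feasibility_factor m n p T \<and> 0 < h \<and> h \<le> 1 \<and> lp_feasible m n p T L"
  define H where "H = Min ((\<lambda>j. card {i. i < m \<and> p i j \<le> T}) ` {..<n})"
  have h: "h = real H / real m" using a by (simp add: feasibility_factor_def H_def)
  have "0 < H" using h a by (cases "H = 0") auto
  hence feas: "feasible_scheduling m n p T L H"
    using a H_def by (intro lp_feasible_scheduling) auto
  have "\<exists>\<alpha>. feasible_scheduling.solves m n p T L H \<alpha> \<and>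
      (\<forall>q T' L'. (\<forall>i<m. \<forall>j<n. p i j = real_of_rat (q i j)) \<and> T = real_of_rat T' \<and> L = real_of_rat L' \<longrightarrow>
        outputs scheduler m n q T' L' \<alpha>)"
  \<comment> \<open>For irrational data the demand on the output is vacuous and a bare existence
    proof suffices. Rational data determine the input memory, so the assignment from one run serves
    for all representations.\<close>
  proof (cases "\<exists>q T' L'. (\<forall>i<m. \<forall>j<n. p i j = real_of_rat (q i j)) \<and> T = real_of_rat T' \<and> L = real_of_rat L'")
    case False
    thus ?thesis using feasible_scheduling.solution_exists[OF feas] by blast
  next
    case True
    then obtain q T' L' where q: "\<forall>i<m. \<forall>j<n. p i j = real_of_rat (q i j)" and
      T: "T = real_of_rat T'" and L: "L = real_of_rat L'" by blast
    have "0 < n" using a by (simp add: is_instance_def)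
    from scheduler_correct[OF feas[unfolded T L] this q H_def[unfolded T]]
    obtain \<alpha> where \<alpha>: "feasible_scheduling.solves m n p T L H \<alpha>" "outputs scheduler m n q T' L' \<alpha>"
      unfolding T L by blast
    have "outputs scheduler m n q2 T2 L2 \<alpha>"
      if "\<forall>i<m. \<forall>j<n. p i j = real_of_rat (q2 i j)" "T = real_of_rat T2" "L = real_of_rat L2" for q2 T2 L2
    proof -
      have "T2 = T'" "L2 = L'" using that(2,3) T L by auto
      moreover have "\<forall>i<m. \<forall>j<n. q2 i j = q i j" using that(1) q by (metis of_rat_eq_iff)
      from input_state_cong[OF this] have "input_state m n q2 T' L' = input_state m n q T' L'" .
      ultimately show ?thesis using \<alpha>(2) by (simp add: outputs_def)
    qed
    thus ?thesis using \<alpha>(1) by blast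
  qed
  thus "\<exists>\<alpha>. is_assignment m n \<alpha> \<and> makespan m n p \<alpha> \<le> min (T + L / h) (2 * T) \<and>
      (\<forall>q T' L'. (\<forall>i<m. \<forall>j<n. p i j = real_of_rat (q i j)) \<and> T = real_of_rat T' \<and> L = real_of_rat L' \<longrightarrow>
        outputs scheduler m n q T' L' \<alpha>)"
    using solves_makespan[OF feas _ h] by blast
qed

end
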